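(* Let $k\geq2$ be an integer and let $\mathcal{S}$ be a ring with $\mathbb{Q}\subseteq\mathcal{S}\subseteq\mathbb{A}$, where $\mathbb{A}$ is the set of real algebraic numbers. The decision problem "Given a $k$-regular sequence $(f(n))_{n\geq0}$ over $\mathcal{S}$, is $(f(n))_{n\geq0}$ bounded?" is recursively unsolvable.
   Context: For $n\in\mathbb{N}_0$ let $(n)_k=n_{s-1}\cdots n_0$ be the standard base-$k$ representation of $n$ (no leading zeros; $(0)_k$ empty). A sequence $(f(n))_{n\geq0}$ over $\mathcal{S}$ is $k$-regular if there exist $r\geq0$, a $1\times r$ row vector $v$, an $r\times1$ column vector $w$ and $r\times r$ matrices $M_0,\dots,M_{k-1}$ with entries in $\mathcal{S}$ such that $f(n)=vM_{n_0}\cdots M_{n_{s-1}}w$ for all $n$. The input of the decision problem is such a linear representation; a real algebraic number is given by its minimal polynomial together with a rational interval containing it and none of its conjugates. *)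

theory Defs
  imports "Jordan_Normal_Form.Matrix" "HOL-Computational_Algebra.Polynomial"
    "HOL-Computational_Algebra.Factorial_Ring" "HOL-Library.Nat_Bijection"
begin

datatype recf = Zero | Succ | Proj nat | Comp recf "recf list" | PrimRec recf recf | Minim recf

inductive eval :: "recf \<Rightarrow> nat list \<Rightarrow> nat \<Rightarrow> bool" where
  eval_Zero: "eval Zero xs 0"
| eval_Succ: "eval Succ (x # xs) (Suc x)"
| eval_Proj: "i < length xs \<Longrightarrow> eval (Proj i) xs (xs ! i)"
| eval_Comp: "length ys = length gs \<Longrightarrow> (\<forall>i < length gs. eval (gs ! i) xs (ys ! i))
              \<Longrightarrow> eval f ys z \<Longrightarrow> eval (Comp f gs) xs z"
| eval_PrimRec_0: "eval f xs y \<Longrightarrow> eval (PrimRec f g) (0 # xs) y"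
| eval_PrimRec_Suc: "eval (PrimRec f g) (n # xs) y \<Longrightarrow> eval g (y # n # xs) z
              \<Longrightarrow> eval (PrimRec f g) (Suc n # xs) z"
| eval_Minim: "eval f (n # xs) 0 \<Longrightarrow> (\<forall>m < n. \<exists>y. 0 < y \<and> eval f (m # xs) y)
              \<Longrightarrow> eval (Minim f) xs n"

type_synonym rat_code = "int \<times> int"

definition rat_of_code :: "rat_code \<Rightarrow> rat" where
  "rat_of_code c = of_int (fst c) / of_int (snd c)"

definition valid_rat_code :: "rat_code \<Rightarrow> bool" where
  "valid_rat_code c \<longleftrightarrow> snd c \<noteq> 0"

text \<open>A real algebraic number is given by its minimal polynomial (list of rational
  coefficients, lowest degree first) and a closed rational interval [lo, hi]
  containing the number and none of its conjugates.\<close>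
type_synonym alg_code = "rat_code list \<times> rat_code \<times> rat_code"

definition alg_denotes :: "alg_code \<Rightarrow> real \<Rightarrow> bool" where
  "alg_denotes c \<alpha> \<longleftrightarrow>
     (case c of (cs, lo, hi) \<Rightarrow>
       (\<forall>q \<in> set cs. valid_rat_code q) \<and> valid_rat_code lo \<and> valid_rat_code hi \<and>
       (let P = Poly (map rat_of_code cs); PR = map_poly (of_rat :: rat \<Rightarrow> real) P in
          lead_coeff P = 1 \<and> irreducible P \<and> poly PR \<alpha> = 0 \<and>
          of_rat (rat_of_code lo) \<le> \<alpha> \<and> \<alpha> \<le> of_rat (rat_of_code hi) \<and>
          (\<forall>\<beta>. poly PR \<beta> = 0 \<and> of_rat (rat_of_code lo) \<le> \<beta> \<and> \<beta> \<le> of_rat (rat_of_code hi)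
                \<longrightarrow> \<beta> = \<alpha>)))"

text \<open>A linear representation is given by the row vector v, the column vector w
  and the list of matrices M_0, ..., M_{k-1} (each as a list of rows).\<close>
type_synonym lrep_code = "alg_code list \<times> alg_code list \<times> alg_code list list list"

definition enc_rat :: "rat_code \<Rightarrow> nat" where
  "enc_rat c = prod_encode (int_encode (fst c), int_encode (snd c))"

definition enc_alg :: "alg_code \<Rightarrow> nat" where
  "enc_alg c = (case c of (cs, lo, hi) \<Rightarrow>
      list_encode [list_encode (map enc_rat cs), enc_rat lo, enc_rat hi])"

definition enc_vec :: "alg_code list \<Rightarrow> nat" where
  "enc_vec xs = list_encode (map enc_alg xs)"

definition enc_mat :: "alg_code list list \<Rightarrow> nat" where
  "enc_mat m = list_encode (map enc_vec m)"

definition enc_lrep :: "lrep_code \<Rightarrow> nat" where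
  "enc_lrep c = (case c of (vc, wc, Mcs) \<Rightarrow>
      list_encode [enc_vec vc, enc_vec wc, list_encode (map enc_mat Mcs)])"

fun digits :: "nat \<Rightarrow> nat \<Rightarrow> nat list" where
  "digits k n = (if n = 0 \<or> k < 2 then [] else n mod k # digits k (n div k))"

definition lrep_seq :: "nat \<Rightarrow> real mat \<Rightarrow> real mat list \<Rightarrow> real mat \<Rightarrow> nat \<Rightarrow> real" where
  "lrep_seq k v Ms w n = (foldl (\<lambda>A d. A * Ms ! d) v (digits k n) * w) $$ (0, 0)"

definition lrep_denotes :: "nat \<Rightarrow> real set \<Rightarrow> lrep_code \<Rightarrow> real mat \<Rightarrow> real mat list \<Rightarrow> real mat \<Rightarrow> bool" where
  "lrep_denotes k S c v Ms w \<longleftrightarrow>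
     (case c of (vc, wc, Mcs) \<Rightarrow>
       (let r = length vc; ok = (\<lambda>a x. alg_denotes a x \<and> x \<in> S) in
         length wc = r \<and> length Mcs = k \<and>
         (\<forall>M \<in> set Mcs. length M = r \<and> (\<forall>row \<in> set M. length row = r)) \<and>
         v \<in> carrier_mat 1 r \<and> w \<in> carrier_mat r 1 \<and> length Ms = k \<and>
         (\<forall>j < r. ok (vc ! j) (v $$ (0, j)) \<and> ok (wc ! j) (w $$ (j, 0))) \<and>
         (\<forall>d < k. Ms ! d \<in> carrier_mat r r \<and>
            (\<forall>i < r. \<forall>j < r. ok (Mcs ! d ! i ! j) (Ms ! d $$ (i, j))))))"

definition bounded_seq :: "(nat \<Rightarrow> real) \<Rightarrow> bool" where
  "bounded_seq f \<longleftrightarrow> (\<exists>B. \<forall>n. \<bar>f n\<bar> \<le> B)"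

end

theory Submission
  imports Defs "HOL-Computational_Algebra.Polynomial_Factorial"
begin

text \<open>Every recursively enumerable set of numbers is described by a family of linear representations in which
  the parameter \<open>X\<close> occurs only in simple entries, such that the sequence belonging to \<open>X\<close> is unbounded iff
  \<open>X\<close> is in the set. A recursive function is evaluated by a nondeterministic program that only increments,
  clears, copies and compares registers, hence by integer vectors that are multiplied by matrices and tested
  for the vanishing of linear forms. Along a word of matrices the sum \<open>g\<close> of the squares of the tested forms is
  computed by a linear representation, and so is \<open>h = 1 + e * (1 - 2 * g)\<close> with a positive \<open>e\<close> so small that
  \<open>h \<ge> -1\<close>. For a valid accepting run \<open>h > 1\<close>, otherwise \<open>h \<le> 1\<close>, so the products of the numbers \<open>h\<close> over
  sequences of words are unbounded iff there is an accepting run. A program deciding boundedness is then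
  refuted by a diagonal argument in which \<open>X\<close> encodes the remaining entries of the representation itself.\<close>

section \<open>Recursive functions\<close>

text \<open>The difficulty is that every word counts: a word that is not a valid run must not
  increase the product in absolute value. Integrality settles one side: a sum of squares of integers
  that is not 0 is at least 1, so one failed test already makes \<open>1 - 2 * g\<close> at most -1.
  For the other side the weight has to outrun the tested forms: by Cauchy-Schwarz each letter
  multiplies squared lengths by at most a constant \<open>K\<close>, so the weight starts at the
  inverse squared length of the initial state and is divided by \<open>K\<close> at each letter.
  Squares of forms are linear in the products of the coordinates, so the representation carries the
  tensor square of the state. The diagonal argument does without the recursion theorem. The machine
  is built from the supposed decision program alone; the entries free of \<open>X\<close> are then
  fixed, and \<open>X\<close> is defined as their code. The machine searches for a tuple with code
  \<open>X\<close>, rebuilds the code of the whole representation and asks the decision program. As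
  tuples are guessed, codes are only built, never taken apart.\<close>

inductive_cases eval_ZeroE: "eval Zero xs y"
inductive_cases eval_SuccE: "eval Succ xs y"
inductive_cases eval_ProjE: "eval (Proj i) xs y"
inductive_cases eval_CompE: "eval (Comp f gs) xs y"
inductive_cases eval_PrimRec_0E: "eval (PrimRec f g) (0 # xs) y"
inductive_cases eval_PrimRec_SucE: "eval (PrimRec f g) (Suc n # xs) y"
inductive_cases eval_PrimRecE: "eval (PrimRec f g) xs y"
inductive_cases eval_MinimE: "eval (Minim f) xs y"

lemma eval_deterministic: "eval f xs y \<Longrightarrow> eval f xs z \<Longrightarrow> y = z"
proof (induction arbitrary: z rule: eval.induct)
  case (eval_Comp ys gs xs f v)
  from eval_Comp.prems obtain zs where zs: "length zs = length gs"
    "\<forall>i<length gs. eval (gs ! i) xs (zs ! i)" "eval f zs z"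
    by (elim eval_CompE) blast
  have "ys = zs"
  proof (rule nth_equalityI)
    show "length ys = length zs" using eval_Comp.hyps(1) zs(1) by simp
    fix i assume "i < length ys"
    then show "ys ! i = zs ! i" using eval_Comp.IH(1) eval_Comp.hyps(1) zs(2) by simp
  qed
  with eval_Comp.IH(2) zs(3) show ?case by simp
next
  case (eval_PrimRec_Suc f g n xs y v)
  from eval_PrimRec_Suc.prems obtain y' where "eval (PrimRec f g) (n # xs) y'" "eval g (y' # n # xs) z"
    by (elim eval_PrimRec_SucE) blast
  with eval_PrimRec_Suc.IH show ?case by blast
next
  case (eval_Minim f n xs)
  from eval_Minim.prems have "eval f (z # xs) 0 \<and> (\<forall>m<z. \<exists>y>0. eval f (m # xs) y)"
    by (rule eval_MinimE) (rule conjI)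
  then have z: "eval f (z # xs) 0" "\<And>m. m < z \<Longrightarrow> \<exists>y>0. eval f (m # xs) y"
    by simp_all
  \<comment> \<open>At the smaller of two different minima \<open>f\<close> would have both the
    value 0 and a positive one.\<close>
  show ?case
  proof (rule linorder_cases[of n z])
    assume "n < z"
    then obtain y where "0 < y" "eval f (n # xs) y" using z(2) by blast
    with eval_Minim.IH(1) show ?thesis by blast
  next
    assume "z < n"
    with eval_Minim.IH(2) obtain y where "0 < y" "\<forall>v. eval f (z # xs) v \<longrightarrow> y = v" by blast
    with z(1) show ?thesis by blast
  qed
next
  case (eval_PrimRec_0 f xs y g)
  from eval_PrimRec_0.prems have "eval f xs z" by (rule eval_PrimRec_0E)
  then show ?case by (rule eval_PrimRec_0.IH)
qed (auto elim: eval_ZeroE eval_SuccE eval_ProjE)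

section \<open>Programs for arithmetic and the pairing function\<close>

definition const_rec :: "nat \<Rightarrow> recf" where
  "const_rec n = ((\<lambda>f. Comp Succ [f]) ^^ n) Zero"

definition add_rec :: recf where
  "add_rec = PrimRec (Proj 0) (Comp Succ [Proj 0])"

definition triangle_rec :: recf where
  "triangle_rec = PrimRec Zero (Comp add_rec [Proj 0, Comp Succ [Proj 1]])"

definition mult_rec :: recf where
  "mult_rec = PrimRec Zero (Comp add_rec [Proj 0, Proj 2])"

text \<open>Cantor's pairing is \<open>triangle (x + y) + x\<close>.\<close>

definition prod_encode_rec :: recf where
  "prod_encode_rec = Comp add_rec [Comp triangle_rec [add_rec], Proj 0]"

lemma eval_Comp1: "eval g xs y \<Longrightarrow> eval f [y] z \<Longrightarrow> eval (Comp f [g]) xs z"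
  by (rule eval_Comp[where ys = "[y]"]) auto

lemma eval_Comp2:
  "eval g xs y \<Longrightarrow> eval h xs y' \<Longrightarrow> eval f [y, y'] z \<Longrightarrow> eval (Comp f [g, h]) xs z"
  by (rule eval_Comp[where ys = "[y, y']"]) (auto simp: less_Suc_eq)

lemma eval_Proj_nth: "i < length xs \<Longrightarrow> y = xs ! i \<Longrightarrow> eval (Proj i) xs y"
  by (simp add: eval_Proj)

lemma eval_Comp_Succ: "eval f xs y \<Longrightarrow> eval (Comp Succ [f]) xs (Suc y)"
  by (rule eval_Comp1, assumption, rule eval_Succ)

lemma eval_const_rec: "eval (const_rec n) xs n"
  by (induction n) (auto simp: const_rec_def intro: eval_Zero eval_Comp_Succ)

lemma eval_add_rec: "eval add_rec [x, y] (x + y)"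
  unfolding add_rec_def
proof (induction x)
  case 0
  show ?case by (simp add: eval_PrimRec_0 eval_Proj_nth)
next
  case (Suc x)
  have "eval (Comp Succ [Proj 0]) [x + y, x, y] (Suc (x + y))"
    by (simp add: eval_Comp_Succ eval_Proj_nth)
  with Suc show ?case by (metis add_Suc eval_PrimRec_Suc)
qed

lemma eval_triangle_rec: "eval triangle_rec [x] (triangle x)"
  unfolding triangle_rec_def
proof (induction x)
  case (Suc x)
  have "eval (Comp add_rec [Proj 0, Comp Succ [Proj 1]]) [triangle x, x] (triangle x + Suc x)"
    by (rule eval_Comp2[OF _ _ eval_add_rec]) (simp_all add: eval_Proj_nth eval_Comp_Succ)
  with Suc show ?case
    by (metis eval_PrimRec_Suc triangle_Suc)
qed (simp add: eval_PrimRec_0 eval_Zero)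

lemma eval_mult_rec: "eval mult_rec [x, y] (x * y)"
  unfolding mult_rec_def
proof (induction x)
  case (Suc x)
  have "eval (Comp add_rec [Proj 0, Proj 2]) [x * y, x, y] (x * y + y)"
    by (rule eval_Comp2[OF _ _ eval_add_rec]) (simp_all add: eval_Proj_nth)
  with Suc show ?case
    by (metis add.commute eval_PrimRec_Suc mult_Suc)
qed (simp add: eval_PrimRec_0 eval_Zero)

lemma eval_prod_encode_rec: "eval prod_encode_rec [x, y] (prod_encode (x, y))"
proof -
  have "eval (Comp triangle_rec [add_rec]) [x, y] (triangle (x + y))"
    by (rule eval_Comp1[OF eval_add_rec eval_triangle_rec])
  moreover have "eval (Proj 0) [x, y] x"
    by (simp add: eval_Proj_nth)
  ultimately show ?thesis
    unfolding prod_encode_rec_def prod_encode_def using eval_Comp2[OF _ _ eval_add_rec] by simp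
qed

definition computes :: "recf \<Rightarrow> (nat list \<Rightarrow> nat) \<Rightarrow> nat \<Rightarrow> bool" where
  "computes f F n \<longleftrightarrow> (\<forall>xs. length xs = n \<longrightarrow> eval f xs (F xs))"

lemma computes_const: "\<exists>f. computes f (\<lambda>xs. c) n"
  using eval_const_rec unfolding computes_def by blast

lemma computes_nth: "i < n \<Longrightarrow> \<exists>f. computes f (\<lambda>xs. xs ! i) n"
  using eval_Proj unfolding computes_def by blast

lemma computes_Suc: "\<exists>f. computes f F n \<Longrightarrow> \<exists>f. computes f (\<lambda>xs. Suc (F xs)) n"
  using eval_Comp_Succ unfolding computes_def by blast

lemma computes_add:
  "\<exists>f. computes f F n \<Longrightarrow> \<exists>f. computes f G n \<Longrightarrow> \<exists>f. computes f (\<lambda>xs. F xs + G xs) n"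
  using eval_Comp2[OF _ _ eval_add_rec] unfolding computes_def by blast

lemma computes_mult:
  "\<exists>f. computes f F n \<Longrightarrow> \<exists>f. computes f G n \<Longrightarrow> \<exists>f. computes f (\<lambda>xs. F xs * G xs) n"
  using eval_Comp2[OF _ _ eval_mult_rec] unfolding computes_def by blast

lemma computes_prod_encode:
  "\<exists>f. computes f F n \<Longrightarrow> \<exists>f. computes f G n \<Longrightarrow> \<exists>f. computes f (\<lambda>xs. prod_encode (F xs, G xs)) n"
  using eval_Comp2[OF _ _ eval_prod_encode_rec] unfolding computes_def by blast

text \<open>Applied along the structure of a term, these rules assemble a program for it; hence the
  existential in their premises.\<close>

lemmas computes_intros = computes_const computes_nth computes_Suc computes_add computes_mult
  computes_prod_encode

section \<open>Nondeterministic register programs\<close>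

type_synonym regs = "nat \<Rightarrow> nat"

text \<open>Each update is an affine map of the registers and each test the vanishing of a linear
  form, as affine machines demand. Branching comes only from \<open>Star\<close>, whose wrong
  choices are discarded by later tests.\<close>

datatype instr = Inc nat | Clr nat | Cpy nat nat | Tst nat nat

datatype prog = At instr | Fail | Seq prog prog | Star prog

fun instr_rel :: "instr \<Rightarrow> (regs \<times> regs) set" where
  "instr_rel (Inc r) = {(z, z(r := Suc (z r))) | z. True}"
| "instr_rel (Clr r) = {(z, z(r := 0)) | z. True}"
| "instr_rel (Cpy r q) = {(z, z(r := z q)) | z. True}"
| "instr_rel (Tst r q) = {(z, z) | z. z r = z q}"

fun sem :: "prog \<Rightarrow> (regs \<times> regs) set" where
  "sem (At i) = instr_rel i"
| "sem Fail = {}"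
| "sem (Seq p q) = sem p O sem q"
| "sem (Star p) = (sem p)\<^sup>*"

text \<open>\<open>Tst 0 0\<close> always succeeds and serves as the empty program.\<close>

fun seqs :: "prog list \<Rightarrow> prog" where
  "seqs [] = At (Tst 0 0)"
| "seqs (p # ps) = Seq p (seqs ps)"

definition guess :: "nat \<Rightarrow> prog" where
  "guess r = Seq (At (Clr r)) (Star (At (Inc r)))"

lemma sem_seqs_Nil: "(z, z') \<in> sem (seqs []) \<longleftrightarrow> z' = z"
  by auto

lemma sem_seqs_Cons: "(z, z') \<in> sem (seqs (p # ps)) \<longleftrightarrow> (\<exists>y. (z, y) \<in> sem p \<and> (y, z') \<in> sem (seqs ps))"
  by auto

lemma sem_Inc: "(z, z') \<in> sem (At (Inc r)) \<longleftrightarrow> z' = z(r := Suc (z r))"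
  by auto

lemma sem_Clr: "(z, z') \<in> sem (At (Clr r)) \<longleftrightarrow> z' = z(r := 0)"
  by auto

lemma sem_Cpy: "(z, z') \<in> sem (At (Cpy r q)) \<longleftrightarrow> z' = z(r := z q)"
  by auto

lemma sem_Tst: "(z, z') \<in> sem (At (Tst r q)) \<longleftrightarrow> z' = z \<and> z r = z q"
  by auto

lemma sem_guess: "(z, z') \<in> sem (guess r) \<longleftrightarrow> (\<exists>x. z' = z(r := x))"
proof
  assume "(z, z') \<in> sem (guess r)"
  then have "(z(r := 0), z') \<in> (sem (At (Inc r)))\<^sup>*"
    by (auto simp: guess_def)
  then show "\<exists>x. z' = z(r := x)"
  proof (induction rule: rtrancl_induct)
    case (step y w)
    then obtain x where "y = z(r := x)" by blast
    with step.hyps(2) have "w = z(r := Suc x)" by auto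
    then show ?case by blast
  qed blast
next
  have "(z(r := 0), z(r := x)) \<in> (sem (At (Inc r)))\<^sup>*" for x
  proof (induction x)
    case (Suc x)
    have "(z(r := x), z(r := Suc x)) \<in> sem (At (Inc r))" by auto
    with Suc show ?case by (rule rtrancl_into_rtrancl)
  qed simp
  moreover assume "\<exists>x. z' = z(r := x)"
  ultimately show "(z, z') \<in> sem (guess r)"
    unfolding guess_def by (auto intro: relcompI[of _ "z(r := 0)"] simp del: sem.simps(1) simp: sem_Clr)
qed

lemmas sem_prog_simps = sem_seqs_Nil sem_seqs_Cons sem_Inc sem_Clr sem_Cpy sem_Tst sem_guess

text \<open>\<open>compile f args out b\<close> writes \<open>f\<close> of the registers \<open>args\<close> to the register \<open>out\<close>, with scratch
  registers from \<open>b\<close> on. The programs are nondeterministic: they guess numbers and check them.\<close>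

fun compile :: "recf \<Rightarrow> nat list \<Rightarrow> nat \<Rightarrow> nat \<Rightarrow> prog"
  and compiles :: "recf list \<Rightarrow> nat list \<Rightarrow> nat \<Rightarrow> nat \<Rightarrow> prog" where
  "compile Zero args out b = At (Clr out)"
| "compile Succ args out b =
    (case args of [] \<Rightarrow> Fail | a # as \<Rightarrow> seqs [At (Cpy out a), At (Inc out)])"
| "compile (Proj i) args out b = (if i < length args then At (Cpy out (args ! i)) else Fail)"
| "compile (Comp f gs) args out b =
    Seq (compiles gs args b (b + length gs)) (compile f [b..<b + length gs] out (b + length gs))"
| "compile (PrimRec f g) args out b = (case args of [] \<Rightarrow> Fail | a # as \<Rightarrow>
    seqs [compile f as b (b + 3), At (Clr (b + 1)),
      Star (seqs [compile g (b # (b + 1) # as) (b + 2) (b + 3), At (Cpy b (b + 2)), At (Inc (b + 1))]),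
      At (Tst (b + 1) a), At (Cpy out b)])"
| "compile (Minim f) args out b =
    seqs [At (Clr b),
      Star (seqs [compile f (b # args) (b + 1) (b + 3), guess (b + 2), At (Inc (b + 2)),
        At (Tst (b + 1) (b + 2)), At (Inc b)]),
      compile f (b # args) (b + 1) (b + 3), At (Clr (b + 2)), At (Tst (b + 1) (b + 2)), At (Cpy out b)]"
| "compiles [] args j b = At (Tst 0 0)"
| "compiles (g # gs) args j b = Seq (compile g args j b) (compiles gs args (Suc j) b)"

definition agree :: "nat \<Rightarrow> nat \<Rightarrow> regs \<Rightarrow> regs \<Rightarrow> bool" where
  "agree b out z z' \<longleftrightarrow> (\<forall>r < b. r \<noteq> out \<longrightarrow> z' r = z r)"

text \<open>Every successful run must be correct, and a defined value must be reached by some run;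
  an undefined value thus shows as the absence of runs. Registers from \<open>b\<close> on may end
  with any content.\<close>

definition computes_in :: "recf \<Rightarrow> bool" where
  "computes_in f \<longleftrightarrow> (\<forall>args out b z. set args \<subseteq> {..<b} \<longrightarrow> out < b \<longrightarrow>
     (\<forall>z'. (z, z') \<in> sem (compile f args out b) \<longrightarrow> eval f (map z args) (z' out) \<and> agree b out z z') \<and>
     (\<forall>y. eval f (map z args) y \<longrightarrow>
        (\<exists>z'. (z, z') \<in> sem (compile f args out b) \<and> z' out = y \<and> agree b out z z')))"

lemma computes_inD:
  assumes "computes_in f" "set args \<subseteq> {..<b}" "out < b" "(z, z') \<in> sem (compile f args out b)"
  shows "eval f (map z args) (z' out)" "\<And>r. r < b \<Longrightarrow> r \<noteq> out \<Longrightarrow> z' r = z r"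
  using assms unfolding computes_in_def agree_def by blast+

lemma computes_inE:
  assumes "computes_in f" "set args \<subseteq> {..<b}" "out < b" "eval f (map z args) y"
  obtains z' where "(z, z') \<in> sem (compile f args out b)" "z' out = y" "\<And>r. r < b \<Longrightarrow> r \<noteq> out \<Longrightarrow> z' r = z r"
  using assms unfolding computes_in_def agree_def by blast

lemma computes_inI:
  assumes "\<And>args out b z z'. set args \<subseteq> {..<b} \<Longrightarrow> out < b \<Longrightarrow> (z, z') \<in> sem (compile f args out b) \<Longrightarrow>
      eval f (map z args) (z' out) \<and> (\<forall>r < b. r \<noteq> out \<longrightarrow> z' r = z r)"
    and "\<And>args out b z y. set args \<subseteq> {..<b} \<Longrightarrow> out < b \<Longrightarrow> eval f (map z args) y \<Longrightarrow>
      \<exists>z'. (z, z') \<in> sem (compile f args out b) \<and> z' out = y \<and> (\<forall>r < b. r \<noteq> out \<longrightarrow> z' r = z r)"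
  shows "computes_in f"
  unfolding computes_in_def agree_def using assms by blast

lemma computes_in_Zero: "computes_in Zero"
  by (rule computes_inI) (auto intro: eval_Zero elim: eval_ZeroE)

lemma computes_in_Succ: "computes_in Succ"
proof (rule computes_inI)
  fix args out b and z z' :: regs
  assume "(z, z') \<in> sem (compile Succ args out b)"
  then show "eval Succ (map z args) (z' out) \<and> (\<forall>r<b. r \<noteq> out \<longrightarrow> z' r = z r)"
    by (cases args) (auto intro: eval_Succ)
next
  fix args out b y and z :: regs
  assume "eval Succ (map z args) y"
  then obtain a as where "args = a # as" "y = Suc (z a)"
    by (auto elim!: eval_SuccE)
  then show "\<exists>z'. (z, z') \<in> sem (compile Succ args out b) \<and> z' out = y \<and> (\<forall>r<b. r \<noteq> out \<longrightarrow> z' r = z r)"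
    by (intro exI[of _ "z(out := y)"]) (auto simp: sem_prog_simps simp del: seqs.simps sem.simps)
qed

lemma computes_in_Proj: "computes_in (Proj i)"
proof (rule computes_inI)
  fix args out b and z z' :: regs
  assume "(z, z') \<in> sem (compile (Proj i) args out b)"
  then show "eval (Proj i) (map z args) (z' out) \<and> (\<forall>r<b. r \<noteq> out \<longrightarrow> z' r = z r)"
    by (auto split: if_splits intro!: eval_Proj_nth)
next
  fix args out b y and z :: regs
  assume "eval (Proj i) (map z args) y"
  then have "i < length args" "y = z (args ! i)"
    by (auto elim!: eval_ProjE)
  then show "\<exists>z'. (z, z') \<in> sem (compile (Proj i) args out b) \<and> z' out = y \<and> (\<forall>r<b. r \<noteq> out \<longrightarrow> z' r = z r)"
    by auto
qed

text \<open>The results go to consecutive registers above the arguments and below the scratch space,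
  so later programs disturb neither arguments nor earlier results.\<close>

lemma compiles_sound:
  assumes "\<And>g. g \<in> set gs \<Longrightarrow> computes_in g"
    and "set args \<subseteq> {..<j}" "j + length gs \<le> b" "(z, z') \<in> sem (compiles gs args j b)"
  shows "(\<forall>i < length gs. eval (gs ! i) (map z args) (z' (j + i))) \<and> (\<forall>r < j. z' r = z r)"
  using assms
proof (induction gs arbitrary: j z)
  case (Cons g gs)
  then obtain z1 where z1: "(z, z1) \<in> sem (compile g args j b)" "(z1, z') \<in> sem (compiles gs args (Suc j) b)"
    by auto
  have b: "set args \<subseteq> {..<b}" "j < b" using Cons.prems by auto
  note s = computes_inD[OF Cons.prems(1) b z1(1), simplified]
  have IH: "\<forall>i<length gs. eval (gs ! i) (map z1 args) (z' (Suc j + i))" "\<forall>r<Suc j. z' r = z1 r"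
  proof -
    have "set args \<subseteq> {..<Suc j}" "Suc j + length gs \<le> b" using Cons.prems by auto
    with Cons.IH[of "Suc j" z1] Cons.prems(1) z1(2)
    show "\<forall>i<length gs. eval (gs ! i) (map z1 args) (z' (Suc j + i))" "\<forall>r<Suc j. z' r = z1 r"
      by auto
  qed
  have m: "map z1 args = map z args"
    using s(2) Cons.prems(2,3) by auto
  have "eval ((g # gs) ! i) (map z args) (z' (j + i))" if "i < Suc (length gs)" for i
    using that IH s(1) m by (cases i) auto
  moreover have "z' r = z r" if "r < j" for r
    using IH(2) s(2) that b by auto
  ultimately show ?case by auto
qed auto

lemma compiles_complete:
  assumes "\<And>g. g \<in> set gs \<Longrightarrow> computes_in g"
    and "set args \<subseteq> {..<j}" "j + length gs \<le> b" "length ys = length gs"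
    and "\<forall>i < length gs. eval (gs ! i) (map z args) (ys ! i)"
  shows "\<exists>z'. (z, z') \<in> sem (compiles gs args j b) \<and> (\<forall>i < length gs. z' (j + i) = ys ! i) \<and> (\<forall>r < j. z' r = z r)"
  using assms
proof (induction gs arbitrary: j z ys)
  case (Cons g gs)
  obtain y ys' where ys: "ys = y # ys'" using Cons.prems(4) by (cases ys) auto
  have b: "set args \<subseteq> {..<b}" "j < b" using Cons.prems by auto
  have e: "eval g (map z args) y" using Cons.prems(5) ys by force
  obtain z1 where z1: "(z, z1) \<in> sem (compile g args j b)" "z1 j = y" "\<And>r. r < b \<Longrightarrow> r \<noteq> j \<Longrightarrow> z1 r = z r"
    by (rule computes_inE[OF Cons.prems(1)[of g] b e]) auto
  have m: "map z1 args = map z args"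
    using z1(3) Cons.prems(2,3) by auto
  have "\<exists>z'. (z1, z') \<in> sem (compiles gs args (Suc j) b) \<and> (\<forall>i < length gs. z' (Suc j + i) = ys' ! i)
      \<and> (\<forall>r < Suc j. z' r = z1 r)"
    using Cons.IH[of "Suc j" ys' z1] Cons.prems ys m by force
  then obtain z' where z': "(z1, z') \<in> sem (compiles gs args (Suc j) b)"
    "\<forall>i < length gs. z' (Suc j + i) = ys' ! i" "\<forall>r < Suc j. z' r = z1 r"
    by blast
  have "z' (j + i) = ys ! i" if "i < length (g # gs)" for i
    using that z' z1(2) ys by (cases i) auto
  moreover have "z' r = z r" if "r < j" for r
    using z'(3) z1(3) that b by auto
  ultimately show ?case
    using z1(1) z'(1) by (auto intro!: exI[of _ z'])
qed auto

lemma computes_in_Comp: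
  assumes f: "computes_in f" and gs: "\<And>g. g \<in> set gs \<Longrightarrow> computes_in g"
  shows "computes_in (Comp f gs)"
proof (rule computes_inI)
  fix args out b and z z' :: regs
  let ?b = "b + length gs"
  assume a: "set args \<subseteq> {..<b}" "out < b" "(z, z') \<in> sem (compile (Comp f gs) args out b)"
  then obtain z1 where z1: "(z, z1) \<in> sem (compiles gs args b ?b)" "(z1, z') \<in> sem (compile f [b..<?b] out ?b)"
    by auto
  have b: "set [b..<?b] \<subseteq> {..<?b}" "out < ?b" using a(2) by auto
  have c: "(\<forall>i < length gs. eval (gs ! i) (map z args) (z1 (b + i)))" "\<forall>r < b. z1 r = z r"
    using compiles_sound[OF gs a(1) _ z1(1)] by auto
  have "eval f (map z1 [b..<?b]) (z' out)" "\<And>r. r < ?b \<Longrightarrow> r \<noteq> out \<Longrightarrow> z' r = z1 r"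
    using computes_inD[OF f b z1(2)] by auto
  with c show "eval (Comp f gs) (map z args) (z' out) \<and> (\<forall>r<b. r \<noteq> out \<longrightarrow> z' r = z r)"
    by (auto intro!: eval_Comp[of "map z1 [b..<?b]"])
next
  fix args out b y and z :: regs
  let ?b = "b + length gs"
  assume a: "set args \<subseteq> {..<b}" "out < b" "eval (Comp f gs) (map z args) y"
  from a(3) obtain ys where ys: "length ys = length gs"
    "\<forall>i < length gs. eval (gs ! i) (map z args) (ys ! i)" "eval f ys y"
    by (elim eval_CompE) blast
  obtain z1 where z1: "(z, z1) \<in> sem (compiles gs args b ?b)" "\<forall>i < length gs. z1 (b + i) = ys ! i"
    "\<forall>r < b. z1 r = z r"
    using compiles_complete[OF gs a(1) _ ys(1,2), of ?b] by auto
  have "map z1 [b..<?b] = ys"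
    using z1(2) ys(1) by (auto intro: nth_equalityI)
  then have e: "eval f (map z1 [b..<?b]) y" using ys(3) by simp
  obtain z' where "(z1, z') \<in> sem (compile f [b..<?b] out ?b)" "z' out = y"
    "\<And>r. r < ?b \<Longrightarrow> r \<noteq> out \<Longrightarrow> z' r = z1 r"
    by (rule computes_inE[OF f _ _ e, of ?b out]) (use a(2) in auto)
  with z1 show "\<exists>z'. (z, z') \<in> sem (compile (Comp f gs) args out b) \<and> z' out = y \<and> (\<forall>r<b. r \<noteq> out \<longrightarrow> z' r = z r)"
    by (intro exI[of _ z']) auto
qed

text \<open>Register \<open>b\<close> holds the current value, \<open>b + 1\<close> the counter,
  \<open>b + 2\<close> the next value. The loop may stop at any time; the test of the counter
  against the first argument accepts only the right moment.\<close>

lemma computes_in_PrimRec: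
  assumes f: "computes_in f" and g: "computes_in g"
  shows "computes_in (PrimRec f g)"
proof (rule computes_inI)
  fix args out b and z z' :: regs
  assume ab: "set args \<subseteq> {..<b}" "out < b" "(z, z') \<in> sem (compile (PrimRec f g) args out b)"
  then obtain a as where args: "args = a # as" by (cases args) auto
  let ?body = "seqs [compile g (b # (b + 1) # as) (b + 2) (b + 3), At (Cpy b (b + 2)), At (Inc (b + 1))]"
  obtain z1 z2 where z1: "(z, z1) \<in> sem (compile f as b (b + 3))"
    and z2: "(z1(b + 1 := 0), z2) \<in> (sem ?body)\<^sup>*" and z': "z2 (b + 1) = z2 a" "z' = z2(out := z2 b)"
    using ab(3) unfolding args compile.simps list.case sem_prog_simps
    by (auto simp: sem_prog_simps simp del: seqs.simps sem.simps(1))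
  have ab': "set as \<subseteq> {..<b + 3}" "a < b" "set as \<subseteq> {..<b}" using ab(1) args by auto
  note f1 = computes_inD[OF f ab'(1) _ z1, simplified]
  have "eval (PrimRec f g) (z2 (b + 1) # map z as) (z2 b) \<and> (\<forall>r < b. z2 r = z r)"
    using z2
  proof (induction rule: rtrancl_induct)
    case base
    show ?case using f1 by (auto intro: eval_PrimRec_0)
  next
    case (step u v)
    then obtain u' where u': "(u, u') \<in> sem (compile g (b # (b + 1) # as) (b + 2) (b + 3))"
      "v = u'(b := u' (b + 2), b + 1 := Suc (u' (b + 1)))"
      unfolding sem_prog_simps by (auto simp del: sem.simps)
    have s: "set (b # (b + 1) # as) \<subseteq> {..<b + 3}" using ab' by auto
    note g1 = computes_inD[OF g s _ u'(1), simplified]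
    have "map u as = map z as" using step.IH ab'(3) by auto
    with g1(1) have "eval g (u b # u (b + 1) # map z as) (u' (b + 2))" by (simp del: map_eq_conv)
    with step.IH have "eval (PrimRec f g) (Suc (u (b + 1)) # map z as) (u' (b + 2))"
      by (auto intro: eval_PrimRec_Suc)
    with g1(2) u'(2) step.IH show ?case by auto
  qed
  with z' args ab' show "eval (PrimRec f g) (map z args) (z' out) \<and> (\<forall>r<b. r \<noteq> out \<longrightarrow> z' r = z r)"
    by auto
next
  fix args out b y and z :: regs
  assume ab: "set args \<subseteq> {..<b}" "out < b" "eval (PrimRec f g) (map z args) y"
  then obtain a as where args: "args = a # as" by (cases args) (auto elim: eval_PrimRecE)
  let ?body = "seqs [compile g (b # (b + 1) # as) (b + 2) (b + 3), At (Cpy b (b + 2)), At (Inc (b + 1))]"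
  have ab': "set as \<subseteq> {..<b + 3}" "a < b" "set as \<subseteq> {..<b}" using ab(1) args by auto
  have loop: "\<exists>z1 z2. (z, z1) \<in> sem (compile f as b (b + 3)) \<and> (z1(b + 1 := 0), z2) \<in> (sem ?body)\<^sup>* \<and>
      z2 b = y \<and> z2 (b + 1) = n \<and> (\<forall>r < b. z2 r = z r)"
    if "eval (PrimRec f g) (n # map z as) y" for n y
    using that
  proof (induction n arbitrary: y)
    case 0
    then have "eval f (map z as) y" by (rule eval_PrimRec_0E)
    then obtain z1 where "(z, z1) \<in> sem (compile f as b (b + 3))" "z1 b = y"
      "\<And>r. r < b + 3 \<Longrightarrow> r \<noteq> b \<Longrightarrow> z1 r = z r"
      by (rule computes_inE[OF f ab'(1), rotated]) auto
    then show ?case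
      by (intro exI[of _ z1] exI[of _ "z1(b + 1 := 0)"]) auto
  next
    case (Suc n)
    then obtain x where x: "eval (PrimRec f g) (n # map z as) x" "eval g (x # n # map z as) y"
      by (elim eval_PrimRec_SucE) blast
    from Suc.IH[OF x(1)] obtain z1 u where u: "(z, z1) \<in> sem (compile f as b (b + 3))"
      "(z1(b + 1 := 0), u) \<in> (sem ?body)\<^sup>*" "u b = x" "u (b + 1) = n" "\<forall>r < b. u r = z r"
      by blast
    have s: "set (b # (b + 1) # as) \<subseteq> {..<b + 3}" using ab' by auto
    have "map u as = map z as" using u ab'(3) by auto
    then have e: "eval g (map u (b # (b + 1) # as)) y" using x(2) u(3,4) by (simp del: map_eq_conv)
    obtain u' where u': "(u, u') \<in> sem (compile g (b # (b + 1) # as) (b + 2) (b + 3))" "u' (b + 2) = y"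
      "\<And>r. r < b + 3 \<Longrightarrow> r \<noteq> b + 2 \<Longrightarrow> u' r = u r"
      by (rule computes_inE[OF g s _ e, of "b + 2"]) auto
    let ?v = "u'(b := y, b + 1 := Suc n)"
    have "u' (b + 1) = n" using u'(3) u by simp
    then have "(u, ?v) \<in> sem ?body"
      using u' unfolding sem_prog_simps by (auto simp del: sem.simps)
    with u(2) have "(z1(b + 1 := 0), ?v) \<in> (sem ?body)\<^sup>*" by (rule rtrancl_into_rtrancl)
    moreover have "\<forall>r < b. ?v r = z r" using u(5) u'(3) by auto
    moreover have "?v b = y" "?v (b + 1) = Suc n" by simp_all
    ultimately show ?case using u(1) by blast
  qed
  have "eval (PrimRec f g) (z a # map z as) y" using ab(3) args by simp
  from loop[OF this] obtain z1 z2 where *: "(z, z1) \<in> sem (compile f as b (b + 3))"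
    "(z1(b + 1 := 0), z2) \<in> (sem ?body)\<^sup>*" "z2 b = y" "z2 (b + 1) = z a" "\<forall>r < b. z2 r = z r"
    by blast
  have "z2 (b + 1) = z2 a" using *(4,5) ab'(2) by simp
  with *(1,2) have "(z, z2(out := z2 b)) \<in> sem (compile (PrimRec f g) args out b)"
    unfolding args compile.simps list.case sem_prog_simps sem.simps(4) by blast
  then have "(z, z2(out := y)) \<in> sem (compile (PrimRec f g) args out b)"
    unfolding *(3) .
  with * show "\<exists>z'. (z, z') \<in> sem (compile (PrimRec f g) args out b) \<and> z' out = y \<and> (\<forall>r<b. r \<noteq> out \<longrightarrow> z' r = z r)"
    by (intro exI[of _ "z2(out := y)"]) auto
qed

text \<open>Register \<open>b\<close> holds the candidate and \<open>b + 1\<close> the value of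
  \<open>f\<close> there. That this value is positive is checked by guessing its predecessor in
  \<open>b + 2\<close>, incrementing and comparing.\<close>

lemma computes_in_Minim:
  assumes f: "computes_in f"
  shows "computes_in (Minim f)"
proof (rule computes_inI)
  fix args out b and z z' :: regs
  assume ab: "set args \<subseteq> {..<b}" "out < b" "(z, z') \<in> sem (compile (Minim f) args out b)"
  let ?body = "seqs [compile f (b # args) (b + 1) (b + 3), guess (b + 2), At (Inc (b + 2)),
        At (Tst (b + 1) (b + 2)), At (Inc b)]"
  have s: "set (b # args) \<subseteq> {..<b + 3}" "b + 1 < b + 3" using ab(1) by auto
  obtain z1 z2 where z1: "(z(b := 0), z1) \<in> (sem ?body)\<^sup>*"
    and z2: "(z1, z2) \<in> sem (compile f (b # args) (b + 1) (b + 3))"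
    and z': "z2 (b + 1) = 0" "z' = z2(b + 2 := 0, out := z2 b)"
    using ab(2,3) unfolding compile.simps sem_prog_simps
    by (auto simp: sem_prog_simps simp del: seqs.simps sem.simps(1))
  have loop: "(\<forall>m < z1 b. \<exists>y>0. eval f (m # map z args) y) \<and> (\<forall>r < b. z1 r = z r)"
    using z1
  proof (induction rule: rtrancl_induct)
    case base
    show ?case by auto
  next
    case (step u v)
    then obtain u' x where u': "(u, u') \<in> sem (compile f (b # args) (b + 1) (b + 3))"
      "u' (b + 1) = Suc x" "v = u'(b + 2 := Suc x, b := Suc (u' b))"
      unfolding sem_prog_simps by (auto simp del: sem.simps)
    note f1 = computes_inD[OF f s u'(1)]
    have "map u args = map z args" using step.IH ab(1) by auto
    with f1(1) u'(2) have "eval f (u b # map z args) (Suc x)" by (simp del: map_eq_conv)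
    moreover have "v b = Suc (u b)" "\<forall>r<b. v r = u r" using u' f1(2) by auto
    ultimately show ?case using step.IH by (auto simp: less_Suc_eq)
  qed
  note f1 = computes_inD[OF f s z2]
  have "map z1 args = map z args" using loop ab(1) by auto
  with f1(1) z'(1) have "eval f (z1 b # map z args) 0" by (simp del: map_eq_conv)
  with loop have "eval (Minim f) (map z args) (z1 b)" by (auto intro: eval_Minim)
  moreover have "z' out = z1 b" "\<forall>r<b. r \<noteq> out \<longrightarrow> z' r = z1 r" using z' f1(2) ab(2) by auto
  ultimately show "eval (Minim f) (map z args) (z' out) \<and> (\<forall>r<b. r \<noteq> out \<longrightarrow> z' r = z r)"
    using loop by auto
next
  fix args out b y and z :: regs
  assume ab: "set args \<subseteq> {..<b}" "out < b" "eval (Minim f) (map z args) y"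
  let ?body = "seqs [compile f (b # args) (b + 1) (b + 3), guess (b + 2), At (Inc (b + 2)),
        At (Tst (b + 1) (b + 2)), At (Inc b)]"
  have s: "set (b # args) \<subseteq> {..<b + 3}" "b + 1 < b + 3" using ab(1) by auto
  from ab(3) have min: "eval f (y # map z args) 0 \<and> (\<forall>m<y. \<exists>x>0. eval f (m # map z args) x)"
    by (rule eval_MinimE) (rule conjI)
  have "\<exists>u. (z(b := 0), u) \<in> (sem ?body)\<^sup>* \<and> u b = n \<and> (\<forall>r < b. u r = z r)" if "n \<le> y" for n
    using that
  proof (induction n)
    case 0
    show ?case by (intro exI[of _ "z(b := 0)"]) auto
  next
    case (Suc n)
    from Suc.IH[OF Suc_leD[OF Suc.prems]] obtain u
      where u: "(z(b := 0), u) \<in> (sem ?body)\<^sup>*" "u b = n" "\<forall>r < b. u r = z r"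
      by blast
    from min Suc.prems obtain x where "x > 0" "eval f (n # map z args) x" by (meson Suc_le_lessD)
    moreover have "map u args = map z args" using u(3) ab(1) by auto
    ultimately have e: "eval f (map u (b # args)) x" using u(2) by (simp del: map_eq_conv)
    obtain u' where u': "(u, u') \<in> sem (compile f (b # args) (b + 1) (b + 3))" "u' (b + 1) = x"
      "\<And>r. r < b + 3 \<Longrightarrow> r \<noteq> b + 1 \<Longrightarrow> u' r = u r"
      by (rule computes_inE[OF f s e]) auto
    obtain x' where x': "x = Suc x'" using \<open>x > 0\<close> by (cases x) auto
    let ?v = "u'(b + 2 := x, b := Suc n)"
    have "u' b = n" using u'(3) u(2) by simp
    then have "(u, ?v) \<in> sem ?body"
      using u' x' unfolding sem_prog_simps
      by (intro exI[of _ u'] conjI exI[of _ "u'(b + 2 := x')"] exI[of _ "u'(b + 2 := x)"]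
          exI[of _ x'] exI[of _ ?v]) auto
    with u(1) have "(z(b := 0), ?v) \<in> (sem ?body)\<^sup>*" by (rule rtrancl_into_rtrancl)
    moreover have "\<forall>r < b. ?v r = z r" using u(3) u'(3) by auto
    moreover have "?v b = Suc n" by simp
    ultimately show ?case by blast
  qed
  then obtain u where u: "(z(b := 0), u) \<in> (sem ?body)\<^sup>*" "u b = y" "\<forall>r < b. u r = z r"
    by blast
  have "map u args = map z args" using u(3) ab(1) by auto
  then have e: "eval f (map u (b # args)) 0" using min u(2) by (simp del: map_eq_conv)
  obtain u' where u': "(u, u') \<in> sem (compile f (b # args) (b + 1) (b + 3))" "u' (b + 1) = 0"
    "\<And>r. r < b + 3 \<Longrightarrow> r \<noteq> b + 1 \<Longrightarrow> u' r = u r"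
    by (rule computes_inE[OF f s e]) auto
  let ?v = "u'(b + 2 := 0, out := y)"
  have "(u'(b + 2 := 0)) (b + 1) = (u'(b + 2 := 0)) (b + 2)" "(u'(b + 2 := 0)) b = y"
    using u'(2,3) u(2) by simp_all
  then have "(u'(b + 2 := 0), ?v) \<in> sem (seqs [At (Tst (b + 1) (b + 2)), At (Cpy out b)])"
    unfolding sem_prog_simps by metis
  with u(1) u'(1) have "(z, ?v) \<in> sem (compile (Minim f) args out b)"
    unfolding compile.simps sem_seqs_Cons sem_Clr sem.simps(4) by blast
  then show "\<exists>z'. (z, z') \<in> sem (compile (Minim f) args out b) \<and> z' out = y \<and> (\<forall>r<b. r \<noteq> out \<longrightarrow> z' r = z r)"
    using u(3) u'(3) by (intro exI[of _ ?v]) auto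
qed

lemma computes_in: "computes_in f"
  by (induction f) (simp_all add: computes_in_Zero computes_in_Succ computes_in_Proj computes_in_Comp
      computes_in_PrimRec computes_in_Minim)

section \<open>Affine machines\<close>

text \<open>\<open>flow p s t n\<close> is a control flow graph of \<open>p\<close> with entry \<open>s\<close> and exit \<open>t\<close>; its other labels are
  the numbers from \<open>n\<close> below \<open>next_label p n\<close>.\<close>

fun next_label :: "prog \<Rightarrow> nat \<Rightarrow> nat" where
  "next_label (At i) n = n"
| "next_label Fail n = n"
| "next_label (Seq p q) n = next_label q (next_label p (Suc n))"
| "next_label (Star p) n = next_label p (Suc n)"

fun flow :: "prog \<Rightarrow> nat \<Rightarrow> nat \<Rightarrow> nat \<Rightarrow> (nat \<times> instr \<times> nat) list" where
  "flow (At i) s t n = [(s, i, t)]"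
| "flow Fail s t n = []"
| "flow (Seq p q) s t n = flow p s n (Suc n) @ flow q n t (next_label p (Suc n))"
| "flow (Star p) s t n = (s, Tst 0 0, n) # (n, Tst 0 0, t) # flow p n n (Suc n)"

definition step :: "(nat \<times> instr \<times> nat) list \<Rightarrow> ((nat \<times> regs) \<times> (nat \<times> regs)) set" where
  "step T = {((s, z), (t, z')) | s t z z'. \<exists>i. (s, i, t) \<in> set T \<and> (z, z') \<in> instr_rel i}"

definition preserves :: "(nat \<times> instr \<times> nat) list \<Rightarrow> (nat \<Rightarrow> regs set) \<Rightarrow> bool" where
  "preserves T Inv \<longleftrightarrow>
    (\<forall>s i t z z'. (s, i, t) \<in> set T \<longrightarrow> z \<in> Inv s \<longrightarrow> (z, z') \<in> instr_rel i \<longrightarrow> z' \<in> Inv t)"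

lemma preserves_append: "preserves (T @ T') Inv \<longleftrightarrow> preserves T Inv \<and> preserves T' Inv"
  unfolding preserves_def by auto

lemma step_mono: "set T \<subseteq> set T' \<Longrightarrow> step T \<subseteq> step T'"
  unfolding step_def by blast

lemma flow_complete: "(z, z') \<in> sem p \<Longrightarrow> ((s, z), (t, z')) \<in> (step (flow p s t n))\<^sup>*"
proof (induction p arbitrary: s t n z z')
  case (At i)
  then show ?case by (auto simp: step_def intro!: r_into_rtrancl)
next
  case (Seq p q)
  then obtain y where "(z, y) \<in> sem p" "(y, z') \<in> sem q" by auto
  then have "((s, z), (n, y)) \<in> (step (flow p s n (Suc n)))\<^sup>*"
    "((n, y), (t, z')) \<in> (step (flow q n t (next_label p (Suc n))))\<^sup>*"
    using Seq.IH by blast+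
  moreover have "step (flow p s n (Suc n)) \<subseteq> step (flow (Seq p q) s t n)"
    "step (flow q n t (next_label p (Suc n))) \<subseteq> step (flow (Seq p q) s t n)"
    by (rule step_mono, simp)+
  ultimately have "((s, z), (n, y)) \<in> (step (flow (Seq p q) s t n))\<^sup>*"
    "((n, y), (t, z')) \<in> (step (flow (Seq p q) s t n))\<^sup>*"
    using rtrancl_mono by blast+
  then show ?case by (rule rtrancl_trans)
next
  case (Star p)
  let ?T = "flow (Star p) s t n"
  have T: "step (flow p n n (Suc n)) \<subseteq> step ?T"
    by (rule step_mono) auto
  have "(z, z') \<in> (sem p)\<^sup>*" using Star.prems by simp
  then have "((n, z), (n, z')) \<in> (step ?T)\<^sup>*"
  proof (induction rule: rtrancl_induct)
    case (step y w)
    have "((n, y), (n, w)) \<in> (step ?T)\<^sup>*"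
      using Star.IH[OF step.hyps(2)] rtrancl_mono[OF T] by blast
    with step.IH show ?case by (rule rtrancl_trans)
  qed simp
  moreover have "((s, z), (n, z)) \<in> step ?T" "((n, z'), (t, z')) \<in> step ?T"
    unfolding step_def by force+
  ultimately show ?case
    by (meson converse_rtrancl_into_rtrancl rtrancl_into_rtrancl)
qed auto

lemma next_label_ge: "n \<le> next_label p n"
  by (induction p arbitrary: n) (auto, (meson Suc_leD le_trans)+)

lemma flow_labels:
  "(a, i, b) \<in> set (flow p s t n) \<Longrightarrow> s < n \<Longrightarrow> t < n \<Longrightarrow> a < next_label p n \<and> b < next_label p n"
proof (induction p arbitrary: s t n)
  case (Seq p q)
  note le = next_label_ge[of "Suc n" p] next_label_ge[of "next_label p (Suc n)" q]
  from Seq.prems(1) consider "(a, i, b) \<in> set (flow p s n (Suc n))"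
    | "(a, i, b) \<in> set (flow q n t (next_label p (Suc n)))" by auto
  then show ?case
  proof cases
    case 1
    from Seq.IH(1)[OF this] Seq.prems le show ?thesis by auto
  next
    case 2
    from Seq.IH(2)[OF this] Seq.prems le show ?thesis by auto
  qed
next
  case (Star p)
  note le = next_label_ge[of "Suc n" p]
  from Star.prems Star.IH[of n n "Suc n"] le show ?case by auto
qed auto

text \<open>Assertions found for one subgraph survive when labels beyond it are assigned for the
  next one.\<close>

lemma preserves_cong:
  assumes "preserves T Inv" "\<And>s i t. (s, i, t) \<in> set T \<Longrightarrow> s < n \<and> t < n"
    and "\<And>l. l < n \<Longrightarrow> Inv' l = Inv l"
  shows "preserves T Inv'"
  unfolding preserves_def
proof (intro allI impI)
  fix s i t z z'
  assume *: "(s, i, t) \<in> set T" "z \<in> Inv' s" "(z, z') \<in> instr_rel i"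
  then have "Inv' s = Inv s" "Inv' t = Inv t" using assms(2,3) by blast+
  with * assms(1) show "z' \<in> Inv' t" unfolding preserves_def by blast
qed

text \<open>Floyd's method: assertions at entry and exit extend to the inner labels.\<close>

lemma flow_invariant:
  assumes "s < n" "t < n" "\<And>z z'. z \<in> I s \<Longrightarrow> (z, z') \<in> sem p \<Longrightarrow> z' \<in> I t"
  shows "\<exists>J. (\<forall>l < n. J l = I l) \<and> preserves (flow p s t n) J"
  using assms
proof (induction p arbitrary: s t n I)
  case (At i)
  then show ?case by (intro exI[of _ I]) (auto simp: preserves_def)
next
  case Fail
  then show ?case by (intro exI[of _ I]) (auto simp: preserves_def)
next
  case (Seq p q)
  let ?n = "next_label p (Suc n)"
  \<comment> \<open>The strongest postcondition of \<open>p\<close> is the assertion at the middle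
    label.\<close>
  let ?I = "I(n := sem p `` I s)"
  have le: "Suc n \<le> ?n" by (rule next_label_ge)
  have "\<exists>J. (\<forall>l < Suc n. J l = ?I l) \<and> preserves (flow p s n (Suc n)) J"
    by (rule Seq.IH(1)) (use Seq.prems in auto)
  then obtain J where J: "\<forall>l < Suc n. J l = ?I l" "preserves (flow p s n (Suc n)) J" by blast
  have "\<exists>K. (\<forall>l < ?n. K l = J l) \<and> preserves (flow q n t ?n) K"
  proof (rule Seq.IH(2))
    show "n < ?n" "t < ?n" using le Seq.prems by auto
    fix z z' assume "z \<in> J n" "(z, z') \<in> sem q"
    then obtain x where "x \<in> I s" "(x, z') \<in> sem (Seq p q)" using J(1) by auto
    then have "z' \<in> I t" by (rule Seq.prems(3))
    with J(1) Seq.prems(2) show "z' \<in> J t" by simp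
  qed
  then obtain K where K: "\<forall>l < ?n. K l = J l" "preserves (flow q n t ?n) K" by blast
  have "preserves (flow p s n (Suc n)) K"
    by (rule preserves_cong[OF J(2), of ?n]) (use flow_labels Seq.prems K(1) in auto)
  with K(2) have "preserves (flow (Seq p q) s t n) K" by (auto simp: preserves_def)
  moreover have "\<forall>l < n. K l = I l" using K(1) J(1) le by auto
  ultimately show ?case by blast
next
  case (Star p)
  \<comment> \<open>The loop has a fresh head \<open>n\<close>, which is free to carry the loop
    invariant; at \<open>s\<close> and \<open>t\<close> the assertions are prescribed.\<close>
  let ?I = "I(n := (sem p)\<^sup>* `` I s)"
  have "\<exists>J. (\<forall>l < Suc n. J l = ?I l) \<and> preserves (flow p n n (Suc n)) J"
    by (rule Star.IH) (auto intro: rtrancl_into_rtrancl)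
  then obtain J where J: "\<forall>l < Suc n. J l = ?I l" "preserves (flow p n n (Suc n)) J" by blast
  have "J s = I s" "J t = I t" "J n = (sem p)\<^sup>* `` I s"
    using J(1) Star.prems(1,2) by simp_all
  then have "J s \<subseteq> J n" "J n \<subseteq> J t"
    using Star.prems(3) by auto
  then have "preserves [(s, Tst 0 0, n), (n, Tst 0 0, t)] J"
    unfolding preserves_def by fastforce
  with J(2) have "preserves ([(s, Tst 0 0, n), (n, Tst 0 0, t)] @ flow p n n (Suc n)) J"
    unfolding preserves_append by blast
  then have "preserves (flow (Star p) s t n) J" by simp
  moreover have "\<forall>l < n. J l = I l" using J(1) by simp
  ultimately show ?case by blast
qed

lemma preserves_steps:
  assumes "preserves T J" "((s, z), (t, z')) \<in> (step T)\<^sup>*" "z \<in> J s"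
  shows "z' \<in> J t"
  using assms(2,3)
proof (induction rule: rtrancl_induct2)
  case (step a y b w)
  then show ?case using assms(1) unfolding preserves_def step_def by blast
qed

text \<open>Arguing with assertions avoids cutting a path of the graph into pieces that belong to
  the subprograms.\<close>

lemma flow_correct: "((0, z), (1, z')) \<in> (step (flow p 0 1 2))\<^sup>* \<longleftrightarrow> (z, z') \<in> sem p"
proof
  assume *: "((0, z), (1, z')) \<in> (step (flow p 0 1 2))\<^sup>*"
  let ?I = "\<lambda>l. if l = 0 then {z} else {z'. (z, z') \<in> sem p}"
  obtain J where J: "\<forall>l < 2. J l = ?I l" "preserves (flow p 0 1 2) J"
    using flow_invariant[of 0 2 1 ?I p] by auto
  then have "z' \<in> J 1" using preserves_steps[OF J(2) *] by simp
  with J(1) show "(z, z') \<in> sem p" by simp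
qed (rule flow_complete)

section \<open>Simulation of programs by affine machines\<close>

definition coord :: "nat \<Rightarrow> nat \<Rightarrow> int" where
  "coord i j = (if j = i then 1 else 0)"

definition lin :: "nat \<Rightarrow> (nat \<Rightarrow> int) \<Rightarrow> (nat \<Rightarrow> int) \<Rightarrow> int" where
  "lin n \<phi> z = (\<Sum>j<n. \<phi> j * z j)"

text \<open>A letter \<open>(A, \<phi>s)\<close> of an affine machine can be read in state \<open>z\<close> if all forms in \<open>\<phi>s\<close> vanish at \<open>z\<close>,
  and leads to the state \<open>A z\<close>.\<close>

type_synonym letter = "(nat \<Rightarrow> nat \<Rightarrow> int) \<times> (nat \<Rightarrow> int) list"

text \<open>The value 0 beyond the dimension lets states be compared as functions.\<close>

definition upd :: "nat \<Rightarrow> (nat \<Rightarrow> nat \<Rightarrow> int) \<Rightarrow> (nat \<Rightarrow> int) \<Rightarrow> nat \<Rightarrow> int" where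
  "upd n A z = (\<lambda>i. if i < n then lin n (A i) z else 0)"

definition vanish :: "nat \<Rightarrow> (nat \<Rightarrow> int) list \<Rightarrow> (nat \<Rightarrow> int) \<Rightarrow> bool" where
  "vanish n \<phi>s z \<longleftrightarrow> (\<forall>\<phi> \<in> set \<phi>s. lin n \<phi> z = 0)"

definition mstep :: "nat \<Rightarrow> letter list \<Rightarrow> ((nat \<Rightarrow> int) \<times> (nat \<Rightarrow> int)) set" where
  "mstep n Ls = {(z, upd n A z) | A \<phi>s z. (A, \<phi>s) \<in> set Ls \<and> vanish n \<phi>s z}"

definition start :: "nat \<Rightarrow> nat \<Rightarrow> int" where
  "start X = (\<lambda>i. if i = 0 then 1 else if i = 1 then int X else 0)"

definition accepts :: "nat \<Rightarrow> letter list \<Rightarrow> (nat \<Rightarrow> int) list \<Rightarrow> nat \<Rightarrow> bool" where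
  "accepts n Ls F X \<longleftrightarrow> (\<exists>z. (start X, z) \<in> (mstep n Ls)\<^sup>* \<and> vanish n F z)"

lemma lin_coord: "i < n \<Longrightarrow> lin n (coord i) z = z i"
  by (simp add: lin_def coord_def if_distrib[of "\<lambda>x. x * _"] cong: if_cong)

lemma lin_add: "lin n (\<lambda>j. \<phi> j + \<psi> j) z = lin n \<phi> z + lin n \<psi> z"
  by (simp add: lin_def distrib_right sum.distrib)

lemma lin_diff: "lin n (\<lambda>j. \<phi> j - \<psi> j) z = lin n \<phi> z - lin n \<psi> z"
  by (simp add: lin_def left_diff_distrib sum_subtractf)

lemma lin_scale: "lin n (\<lambda>j. c * \<phi> j) z = c * lin n \<phi> z"
  by (simp add: lin_def sum_distrib_left mult.assoc)

lemma lin_zero: "lin n (\<lambda>j. 0) z = 0"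
  by (simp add: lin_def)

lemmas lin_simps = lin_coord lin_add lin_diff lin_scale lin_zero

text \<open>A program over the registers below \<open>m\<close> becomes an affine machine of dimension \<open>m + 2\<close>: coordinate
  0 is the constant 1 and the last coordinate is the program counter.\<close>

definition config_vec :: "nat \<Rightarrow> nat \<times> regs \<Rightarrow> nat \<Rightarrow> int" where
  "config_vec m c = (\<lambda>i. if i = 0 then 1 else if i \<le> m then int (snd c (i - 1))
    else if i = m + 1 then int (fst c) else 0)"

fun instr_bound :: "instr \<Rightarrow> nat" where
  "instr_bound (Inc r) = Suc r"
| "instr_bound (Clr r) = Suc r"
| "instr_bound (Cpy r q) = max (Suc r) (Suc q)"
| "instr_bound (Tst r q) = max (Suc r) (Suc q)"

text \<open>Register \<open>r\<close> is coordinate \<open>Suc r\<close>; adding the constant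
  coordinate 0 makes the increment linear.\<close>

fun instr_row :: "instr \<Rightarrow> nat \<Rightarrow> nat \<Rightarrow> int" where
  "instr_row (Inc r) k = (if k = Suc r then \<lambda>j. coord k j + coord 0 j else coord k)"
| "instr_row (Clr r) k = (if k = Suc r then \<lambda>j. 0 else coord k)"
| "instr_row (Cpy r q) k = (if k = Suc r then coord (Suc q) else coord k)"
| "instr_row (Tst r q) k = coord k"

fun instr_tests :: "instr \<Rightarrow> (nat \<Rightarrow> int) list" where
  "instr_tests (Tst r q) = [\<lambda>j. coord (Suc r) j - coord (Suc q) j]"
| "instr_tests _ = []"

fun letter_of :: "nat \<Rightarrow> nat \<times> instr \<times> nat \<Rightarrow> letter" where
  "letter_of m (s, i, t) =
    ((\<lambda>k. if k = m + 1 then (\<lambda>j. int t * coord 0 j) else instr_row i k),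
     (\<lambda>j. coord (m + 1) j - int s * coord 0 j) # instr_tests i)"

lemma vanish_letter_of:
  assumes "instr_bound i \<le> m"
  shows "vanish (m + 2) (snd (letter_of m (s, i, t))) (config_vec m (pc, z)) \<longleftrightarrow>
    pc = s \<and> (\<exists>z'. (z, z') \<in> instr_rel i)"
  using assms by (cases i) (auto simp: vanish_def lin_simps config_vec_def)

lemma upd_letter_of:
  assumes "instr_bound i \<le> m" "(z, z') \<in> instr_rel i"
  shows "upd (m + 2) (fst (letter_of m (s, i, t))) (config_vec m (pc, z)) = config_vec m (t, z')"
proof
  fix k
  consider "k = 0" | "0 < k" "k \<le> m" | "k = m + 1" | "k \<ge> m + 2" by linarith
  then show "upd (m + 2) (fst (letter_of m (s, i, t))) (config_vec m (pc, z)) k = config_vec m (t, z') k"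
    using assms by cases (cases i; auto simp: upd_def lin_simps config_vec_def)+
qed

lemma mstep_letter_of:
  assumes "\<forall>(s, i, t) \<in> set T. instr_bound i \<le> m"
  shows "(config_vec m c, v) \<in> mstep (m + 2) (map (letter_of m) T) \<longleftrightarrow> (\<exists>c'. (c, c') \<in> step T \<and> v = config_vec m c')"
    (is "?l \<longleftrightarrow> ?r")
proof
  obtain pc z where c: "c = (pc, z)" by fastforce
  {
    assume ?l
    then obtain s i t where *: "(s, i, t) \<in> set T" "vanish (m + 2) (snd (letter_of m (s, i, t))) (config_vec m c)"
      "v = upd (m + 2) (fst (letter_of m (s, i, t))) (config_vec m c)"
      unfolding mstep_def by (auto simp del: letter_of.simps) (metis fst_conv snd_conv)
    have b: "instr_bound i \<le> m" using assms *(1) by auto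
    from *(2) obtain z' where "pc = s" "(z, z') \<in> instr_rel i"
      unfolding c vanish_letter_of[OF b] by blast
    with *(1,3) upd_letter_of[OF b] show ?r
      unfolding c step_def by blast
  next
    assume ?r
    then obtain i t z' where *: "(pc, i, t) \<in> set T" "(z, z') \<in> instr_rel i" "v = config_vec m (t, z')"
      unfolding c step_def by blast
    have b: "instr_bound i \<le> m" using assms *(1) by auto
    have "vanish (m + 2) (snd (letter_of m (pc, i, t))) (config_vec m c)"
      unfolding c vanish_letter_of[OF b] using * by blast
    moreover have "v = upd (m + 2) (fst (letter_of m (pc, i, t))) (config_vec m c)"
      unfolding c upd_letter_of[OF b *(2)] *(3) ..
    moreover have "(fst (letter_of m (pc, i, t)), snd (letter_of m (pc, i, t))) \<in> set (map (letter_of m) T)"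
      using *(1) by (metis image_eqI list.set_map prod.collapse)
    ultimately show ?l unfolding mstep_def by blast
  }
qed

lemma msteps_letter_of:
  assumes "\<forall>(s, i, t) \<in> set T. instr_bound i \<le> m"
  shows "(config_vec m c, v) \<in> (mstep (m + 2) (map (letter_of m) T))\<^sup>* \<longleftrightarrow> (\<exists>c'. (c, c') \<in> (step T)\<^sup>* \<and> v = config_vec m c')"
proof
  assume "(config_vec m c, v) \<in> (mstep (m + 2) (map (letter_of m) T))\<^sup>*"
  then show "\<exists>c'. (c, c') \<in> (step T)\<^sup>* \<and> v = config_vec m c'"
  proof (induction rule: rtrancl_induct)
    case (step y z)
    then obtain c' where c': "(c, c') \<in> (step T)\<^sup>*" "y = config_vec m c'" by blast
    from step.hyps(2) obtain d where "(c', d) \<in> step T" "z = config_vec m d"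
      unfolding c'(2) mstep_letter_of[OF assms] by blast
    with c'(1) show ?case by (blast intro: rtrancl_into_rtrancl)
  qed blast
next
  have "(config_vec m c, config_vec m c') \<in> (mstep (m + 2) (map (letter_of m) T))\<^sup>*" if "(c, c') \<in> (step T)\<^sup>*" for c'
    using that
  proof (induction rule: rtrancl_induct)
    case (step y z)
    then have "(config_vec m y, config_vec m z) \<in> mstep (m + 2) (map (letter_of m) T)"
      using mstep_letter_of[OF assms, of y "config_vec m z"] by blast
    with step.IH show ?case by (rule rtrancl_into_rtrancl)
  qed simp
  then show "\<exists>c'. (c, c') \<in> (step T)\<^sup>* \<and> v = config_vec m c' \<Longrightarrow>
      (config_vec m c, v) \<in> (mstep (m + 2) (map (letter_of m) T))\<^sup>*"
    by blast
qed

lemma prog_affine_machine: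
  "\<exists>n Ls F. 2 \<le> n \<and> (\<forall>L \<in> set Ls. fst L 0 = coord 0) \<and>
    (\<forall>X. accepts n Ls F X \<longleftrightarrow> (\<exists>z. (\<lambda>r. if r = 0 then X else 0, z) \<in> sem p))"
proof -
  let ?T = "flow p 0 1 2"
  \<comment> \<open>The sum bounds all registers in use. \<open>Suc\<close> ensures that coordinate
    1 is register 0, which holds the input, and not the program counter.\<close>
  define m where "m = Suc (sum_list (map (\<lambda>(s, i, t). instr_bound i) ?T))"
  have T: "\<forall>(s, i, t) \<in> set ?T. instr_bound i \<le> m"
  proof (rule ballI)
    fix x assume "x \<in> set ?T"
    moreover obtain s i t where "x = (s, i, t)" by (cases x)
    ultimately show "case x of (s, i, t) \<Rightarrow> instr_bound i \<le> m"
      using member_le_sum_list[of "instr_bound i" "map (\<lambda>(s, i, t). instr_bound i) ?T"]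
      unfolding m_def by force
  qed
  let ?Ls = "map (letter_of m) ?T"
  let ?F = "[\<lambda>j. coord (m + 1) j - coord 0 j]"
  have start: "start X = config_vec m (0, \<lambda>r. if r = 0 then X else 0)" for X
    unfolding start_def config_vec_def m_def by (rule ext) auto
  have F: "vanish (m + 2) ?F (config_vec m c) \<longleftrightarrow> fst c = 1" for c
    by (auto simp: vanish_def lin_simps config_vec_def)
  have "accepts (m + 2) ?Ls ?F X \<longleftrightarrow> (\<exists>z. (\<lambda>r. if r = 0 then X else 0, z) \<in> sem p)" for X
  proof -
    have "accepts (m + 2) ?Ls ?F X \<longleftrightarrow>
        (\<exists>c. ((0, \<lambda>r. if r = 0 then X else 0), c) \<in> (step ?T)\<^sup>* \<and> fst c = 1)"
      unfolding accepts_def start msteps_letter_of[OF T] using F by blast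
    then show ?thesis
      unfolding flow_correct[symmetric] split_paired_Ex by simp
  qed
  moreover have "\<forall>L \<in> set ?Ls. fst L 0 = coord 0"
  proof
    fix L assume "L \<in> set ?Ls"
    then obtain s i t where "L = letter_of m (s, i, t)" by auto
    then show "fst L 0 = coord 0" by (cases i) auto
  qed
  moreover have "2 \<le> m + 2" by simp
  ultimately show ?thesis by blast
qed

section \<open>Weights of runs\<close>

text \<open>Lagrange's argument: the squares of \<open>a i * b j - a j * b i\<close>, summed over
  all pairs, give twice the inequality.\<close>

lemma Cauchy_Schwarz_int:
  fixes a b :: "'a \<Rightarrow> int"
  shows "(\<Sum>i\<in>I. a i * b i)\<^sup>2 \<le> (\<Sum>i\<in>I. a i * a i) * (\<Sum>i\<in>I. b i * b i)"
proof -
  have "2 * (\<Sum>i\<in>I. a i * b i)\<^sup>2 = (\<Sum>i\<in>I. \<Sum>j\<in>I. 2 * (a i * b j) * (a j * b i))"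
    by (simp add: power2_eq_square sum_product sum_distrib_left algebra_simps)
  also have "\<dots> \<le> (\<Sum>i\<in>I. \<Sum>j\<in>I. (a i * b j)\<^sup>2 + (a j * b i)\<^sup>2)"
  proof (intro sum_mono)
    fix i j
    show "2 * (a i * b j) * (a j * b i) \<le> (a i * b j)\<^sup>2 + (a j * b i)\<^sup>2"
      using zero_le_power2[of "a i * b j - a j * b i"] by (simp add: power2_diff)
  qed
  also have "\<dots> = (\<Sum>i\<in>I. \<Sum>j\<in>I. (a i * a i) * (b j * b j)) + (\<Sum>i\<in>I. \<Sum>j\<in>I. (a j * a j) * (b i * b i))"
    by (simp add: sum.distrib power2_eq_square ac_simps)
  also have "(\<Sum>i\<in>I. \<Sum>j\<in>I. (a j * a j) * (b i * b i)) = (\<Sum>i\<in>I. \<Sum>j\<in>I. (a i * a i) * (b j * b j))"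
    by (rule sum.swap)
  also have "(\<Sum>i\<in>I. \<Sum>j\<in>I. (a i * a i) * (b j * b j)) = (\<Sum>i\<in>I. a i * a i) * (\<Sum>i\<in>I. b i * b i)"
    by (simp add: sum_product)
  finally show ?thesis by simp
qed

definition nsq :: "nat \<Rightarrow> (nat \<Rightarrow> int) \<Rightarrow> int" where
  "nsq n z = (\<Sum>j<n. z j * z j)"

definition quad :: "nat \<Rightarrow> (nat \<Rightarrow> int) list \<Rightarrow> (nat \<Rightarrow> int) \<Rightarrow> int" where
  "quad n \<phi>s z = (\<Sum>\<phi>\<leftarrow>\<phi>s. (lin n \<phi> z)\<^sup>2)"

text \<open>The Gram matrix of the forms: through it \<open>quad\<close> becomes linear in the
  products \<open>z i * z j\<close>.\<close>

definition qcoef :: "(nat \<Rightarrow> int) list \<Rightarrow> nat \<Rightarrow> nat \<Rightarrow> int" where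
  "qcoef \<phi>s i j = (\<Sum>\<phi>\<leftarrow>\<phi>s. \<phi> i * \<phi> j)"

lemma lin_square_le: "(lin n \<phi> z)\<^sup>2 \<le> nsq n \<phi> * nsq n z"
  unfolding lin_def nsq_def by (rule Cauchy_Schwarz_int)

lemma nsq_nonneg: "0 \<le> nsq n z"
  unfolding nsq_def by (simp add: sum_nonneg)

lemma quad_nonneg: "0 \<le> quad n \<phi>s z"
  unfolding quad_def by (induction \<phi>s) auto

lemma quad_eq_0_iff: "quad n \<phi>s z = 0 \<longleftrightarrow> vanish n \<phi>s z"
proof (induction \<phi>s)
  case (Cons \<phi> \<phi>s)
  have "quad n (\<phi> # \<phi>s) z = (lin n \<phi> z)\<^sup>2 + quad n \<phi>s z" by (simp add: quad_def)
  then have "quad n (\<phi> # \<phi>s) z = 0 \<longleftrightarrow> lin n \<phi> z = 0 \<and> quad n \<phi>s z = 0"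
    using quad_nonneg[of n \<phi>s z] by (simp add: add_nonneg_eq_0_iff)
  with Cons show ?case by (simp add: vanish_def)
qed (simp_all add: quad_def vanish_def)

lemma quad_le: "quad n \<phi>s z \<le> (\<Sum>\<phi>\<leftarrow>\<phi>s. nsq n \<phi>) * nsq n z"
proof (induction \<phi>s)
  case (Cons \<phi> \<phi>s)
  then show ?case using lin_square_le[of n \<phi> z] by (simp add: quad_def distrib_right)
qed (simp add: quad_def)

lemma quad_qcoef: "quad n \<phi>s z = (\<Sum>i<n. \<Sum>j<n. z i * z j * qcoef \<phi>s i j)"
proof (induction \<phi>s)
  case (Cons \<phi> \<phi>s)
  have "(lin n \<phi> z)\<^sup>2 = (\<Sum>i<n. \<Sum>j<n. z i * z j * (\<phi> i * \<phi> j))"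
    by (simp add: lin_def power2_eq_square sum_product ac_simps)
  with Cons show ?case by (simp add: quad_def qcoef_def distrib_left sum.distrib)
qed (simp add: quad_def qcoef_def)

text \<open>The factor is the squared Frobenius norm of \<open>A\<close>, by Cauchy-Schwarz in each
  row.\<close>

lemma nsq_upd_le: "nsq n (upd n A z) \<le> (\<Sum>i<n. nsq n (A i)) * nsq n z"
proof -
  have "nsq n (upd n A z) = (\<Sum>i<n. (lin n (A i) z)\<^sup>2)"
    by (simp add: nsq_def upd_def power2_eq_square)
  also have "\<dots> \<le> (\<Sum>i<n. nsq n (A i) * nsq n z)"
    by (intro sum_mono lin_square_le)
  finally show ?thesis by (simp add: sum_distrib_right)
qed

text \<open>\<open>H\<close> is occupied only between an end marker and a separator. Otherwise
  \<open>P\<close> carries the product so far, \<open>G\<close> the weighted sum of failed tests,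
  and \<open>T\<close> the weighted tensor square of the state.\<close>

datatype coord_ix = H | P | G | T nat nat

text \<open>After the letters \<open>w\<close> read since the last separator, the state vector is a multiple of \<open>block e z g\<close>, where
  \<open>z\<close> is the state of the affine machine, \<open>g\<close> the sum of the squares of all forms tested along \<open>w\<close>, and
  \<open>e\<close> a positive weight that decreases geometrically in the length of \<open>w\<close>. The end marker replaces it by
  \<open>1 + e' * (1 - 2 * g')\<close>, which exceeds 1 if \<open>g' = 0\<close>, that is if \<open>w\<close> is an accepting run, and is
  between -1 and 1 otherwise. The separator multiplies the initial vector by this number.\<close>

fun block :: "real \<Rightarrow> (nat \<Rightarrow> int) \<Rightarrow> int \<Rightarrow> coord_ix \<Rightarrow> real" where
  "block e z g H = 0"
| "block e z g P = 1"
| "block e z g G = e * g"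
| "block e z g (T i j) = e * (z i * z j)"

definition ended :: "coord_ix \<Rightarrow> real" where
  "ended c = (if c = H then 1 else 0)"

text \<open>The inverse of the squared length of \<open>start X\<close>.\<close>

definition init_weight :: "nat \<Rightarrow> real" where
  "init_weight X = 1 / (X * X + 1)"

section \<open>The linear representation attached to an affine machine\<close>

locale affine_machine =
  fixes n :: nat and Ls :: "letter list" and F :: "(nat \<Rightarrow> int) list"
  assumes dim: "2 \<le> n" and const: "L \<in> set Ls \<Longrightarrow> fst L 0 = coord 0"
begin

definition cost :: "letter \<Rightarrow> int" where
  "cost L = (\<Sum>i<n. nsq n (fst L i)) + (\<Sum>\<phi>\<leftarrow>snd L. nsq n \<phi>)"

text \<open>One constant that dominates the growth of the squared length plus the tested squares for
  every letter, and the final tests; the summand 1 also makes it dominate the old value of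
  \<open>g\<close>.\<close>

definition K :: int where
  "K = 1 + (\<Sum>L\<leftarrow>Ls. cost L) + (\<Sum>\<phi>\<leftarrow>F. nsq n \<phi>)"

lemma sum_list_nsq_nonneg: "0 \<le> (\<Sum>\<phi>\<leftarrow>\<phi>s. nsq n \<phi>)"
  by (rule sum_list_nonneg) (auto simp: nsq_nonneg)

lemma cost_nonneg: "0 \<le> cost L"
  unfolding cost_def by (intro add_nonneg_nonneg sum_nonneg nsq_nonneg sum_list_nsq_nonneg)

lemma K_bounds: "1 \<le> K" "L \<in> set Ls \<Longrightarrow> cost L + 1 \<le> K" "(\<Sum>\<phi>\<leftarrow>F. nsq n \<phi>) + 1 \<le> K"
proof -
  have 1: "0 \<le> (\<Sum>L\<leftarrow>Ls. cost L)" by (rule sum_list_nonneg) (auto simp: cost_nonneg)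
  then show "1 \<le> K" "(\<Sum>\<phi>\<leftarrow>F. nsq n \<phi>) + 1 \<le> K"
    unfolding K_def using sum_list_nsq_nonneg[of F] by auto
  assume "L \<in> set Ls"
  then have "cost L \<le> (\<Sum>L\<leftarrow>Ls. cost L)"
  proof (induction Ls)
    case (Cons L' Ls)
    have "0 \<le> (\<Sum>L\<leftarrow>Ls. cost L)" by (rule sum_list_nonneg) (auto simp: cost_nonneg)
    with Cons cost_nonneg[of L'] show ?case by fastforce
  qed simp
  then show "cost L + 1 \<le> K" unfolding K_def using sum_list_nsq_nonneg[of F] by auto
qed

definition coords :: "coord_ix set" where
  "coords = {H, P, G} \<union> (\<lambda>(i, j). T i j) ` ({..<n} \<times> {..<n})"

lemma finite_coords: "finite coords"
  by (simp add: coords_def)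

lemma coords_mem: "H \<in> coords" "P \<in> coords" "G \<in> coords" "T i j \<in> coords \<longleftrightarrow> i < n \<and> j < n"
  by (auto simp: coords_def)

lemma sum_coords: "sum f coords = f H + f P + f G + (\<Sum>i<n. \<Sum>j<n. f (T i j))"
  for f :: "coord_ix \<Rightarrow> real"
proof -
  have "sum f coords = sum f {H, P, G} + sum f ((\<lambda>(i, j). T i j) ` ({..<n} \<times> {..<n}))"
    unfolding coords_def by (rule sum.union_disjoint) auto
  also have "sum f ((\<lambda>(i, j). T i j) ` ({..<n} \<times> {..<n})) = (\<Sum>(i, j)\<in>{..<n} \<times> {..<n}. f (T i j))"
    by (subst sum.reindex) (auto simp: inj_on_def case_prod_beta)
  finally show ?thesis by (simp add: sum.cartesian_product)
qed

definition num_letters :: nat where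
  "num_letters = length Ls + 2"

definition init :: "nat \<Rightarrow> coord_ix \<Rightarrow> real" where
  "init X = block (init_weight X) (start X) 0"

text \<open>Letter 0 is the separator, letter 1 the end marker, and letter \<open>l + 2\<close> is \<open>Ls ! l\<close>.\<close>

definition sep :: "nat \<Rightarrow> coord_ix \<Rightarrow> coord_ix \<Rightarrow> real" where
  "sep X c c' = (if c = H then init X c' else 0)"

text \<open>As \<open>z 0 = 1\<close>, the coordinate \<open>T 0 0\<close> of a block is the bare
  weight; it supplies the 1 in \<open>1 - 2 * g\<close>.\<close>

definition endm :: "coord_ix \<Rightarrow> coord_ix \<Rightarrow> real" where
  "endm c c' = (if c' = H then (case c of H \<Rightarrow> 0 | P \<Rightarrow> 1 | G \<Rightarrow> - 2 / K
      | T i j \<Rightarrow> ((if i = 0 \<and> j = 0 then 1 else 0) - 2 * qcoef F i j) / K) else 0)"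

text \<open>On the coordinates \<open>T\<close> this is the tensor square of the matrix of
  \<open>L\<close>. Dividing all but \<open>P\<close> by \<open>K\<close> passes to the next
  weight.\<close>

fun inner :: "letter \<Rightarrow> coord_ix \<Rightarrow> coord_ix \<Rightarrow> real" where
  "inner L P P = 1"
| "inner L G G = 1 / K"
| "inner L (T i j) G = real_of_int (qcoef (snd L) i j) / K"
| "inner L (T i j) (T i' j') = real_of_int (fst L i' i * fst L j' j) / K"
| "inner L _ _ = 0"

definition letter_mat :: "nat \<Rightarrow> nat \<Rightarrow> coord_ix \<Rightarrow> coord_ix \<Rightarrow> real" where
  "letter_mat X l = (if l = 0 then sep X else if l = 1 then endm else inner (Ls ! (l - 2)))"

definition apply_mat :: "(coord_ix \<Rightarrow> coord_ix \<Rightarrow> real) \<Rightarrow> (coord_ix \<Rightarrow> real) \<Rightarrow> coord_ix \<Rightarrow> real" where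
  "apply_mat M s c' = (\<Sum>c\<in>coords. s c * M c c')"

lemma sep_ended: "apply_mat (sep X) ended = init X"
  by (rule ext) (simp add: apply_mat_def sum_coords sep_def ended_def)

text \<open>A misplaced letter kills the vector, here and in the next two lemmas, so malformed words
  are harmless.\<close>

lemma sep_block: "apply_mat (sep X) (block e z g) = (\<lambda>_. 0)"
  by (rule ext) (simp add: apply_mat_def sum_coords sep_def)

lemma endm_ended: "apply_mat endm ended = (\<lambda>_. 0)"
  by (rule ext) (simp add: apply_mat_def sum_coords endm_def ended_def)

lemma inner_ended: "apply_mat (inner L) ended = (\<lambda>_. 0)"
proof
  fix c show "apply_mat (inner L) ended c = 0"
    by (cases c) (simp_all add: apply_mat_def sum_coords ended_def)
qed

lemma endm_block:
  assumes "z 0 = 1"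
  shows "apply_mat endm (block e z g) = (\<lambda>c. (1 + e / K * (1 - 2 * (g + quad n F z))) * ended c)"
proof
  fix c
  have *: "(\<Sum>i<n. \<Sum>j<n. e * (z i * z j) * (((if i = 0 \<and> j = 0 then 1 else 0) - 2 * qcoef F i j) / K))
      = e / K * (1 - 2 * quad n F z)" (is "?S = _")
  proof -
    have "?S = (\<Sum>i<n. \<Sum>j<n. e / K * (if j = 0 then if i = 0 then 1 else 0 else 0)
        - e / K * (2 * (z i * z j * qcoef F i j)))"
      by (intro sum.cong) (auto simp: assms algebra_simps diff_divide_distrib)
    also have "\<dots> = e / K * (\<Sum>i<n. \<Sum>j<n. (if j = 0 then if i = 0 then 1 else 0 else 0))
        - e / K * (2 * (\<Sum>i<n. \<Sum>j<n. z i * z j * qcoef F i j))"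
      by (simp only: sum_subtractf sum_distrib_left of_int_sum of_int_mult mult.assoc)
    also have "(\<Sum>i<n. \<Sum>j<n. (if j = 0 then if i = 0 then 1 else 0 else (0::real))) = 1"
      using dim by simp
    finally show ?thesis by (simp add: quad_qcoef right_diff_distrib)
  qed
  show "apply_mat endm (block e z g) c = (1 + e / K * (1 - 2 * (g + quad n F z))) * ended c"
    using * by (cases "c = H") (simp_all add: apply_mat_def sum_coords endm_def ended_def algebra_simps)
qed

lemma inner_block:
  assumes "c \<in> coords"
  shows "apply_mat (inner L) (block e z g) c = block (e / K) (upd n (fst L) z) (g + quad n (snd L) z) c"
proof (cases c)
  case G
  have "(\<Sum>i<n. \<Sum>j<n. e * (z i * z j) * (qcoef (snd L) i j / K)) = e / K * quad n (snd L) z"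
    by (simp add: quad_qcoef sum_distrib_left) (simp add: field_simps)
  then show ?thesis using G by (simp add: apply_mat_def sum_coords distrib_left)
next
  case (T i' j')
  have "(\<Sum>i<n. \<Sum>j<n. e * (z i * z j) * (fst L i' i * fst L j' j / K))
      = e / K * (lin n (fst L i') z * lin n (fst L j') z)"
  proof -
    have "lin n (fst L i') z * lin n (fst L j') z = (\<Sum>i<n. \<Sum>j<n. fst L i' i * z i * (fst L j' j * z j))"
      by (simp add: lin_def sum_product)
    then show ?thesis by (simp add: sum_distrib_left ac_simps)
  qed
  then show ?thesis using T assms by (simp add: apply_mat_def sum_coords coords_mem upd_def)
qed (simp_all add: apply_mat_def sum_coords)

text \<open>Unlike in \<open>mstep\<close>, a letter is applied whether or not its tests succeed;
  failures are recorded in \<open>g\<close>.\<close>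

inductive reach :: "nat \<Rightarrow> real \<Rightarrow> (nat \<Rightarrow> int) \<Rightarrow> int \<Rightarrow> bool" for X where
  reach_start: "reach X (init_weight X) (start X) 0"
| reach_letter: "reach X e z g \<Longrightarrow> L \<in> set Ls \<Longrightarrow>
    reach X (e / K) (upd n (fst L) z) (g + quad n (snd L) z)"

lemma nsq_start: "nsq n (start X) = X * X + 1"
proof -
  have "nsq n (start X) = (\<Sum>j\<in>{0, 1}. start X j * start X j)"
    unfolding nsq_def using dim by (intro sum.mono_neutral_right) (auto simp: start_def)
  then show ?thesis by (simp add: start_def)
qed

text \<open>The fourth property, an equality at the start, is what keeps factors above -1: a letter
  enlarges \<open>g + nsq n z\<close> at most \<open>K\<close> times, and the weight shrinks by
  \<open>K\<close>. The last one holds because squares cannot cancel.\<close>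

lemma reach_props:
  assumes "reach X e z g"
  shows "0 < e" "0 \<le> g" "z 0 = 1" "e * (g + nsq n z) \<le> 1" "g = 0 \<Longrightarrow> (start X, z) \<in> (mstep n Ls)\<^sup>*"
  using assms
proof (induction rule: reach.induct)
  case reach_start
  {
    case 1 show ?case by (simp add: init_weight_def add_nonneg_pos)
  next
    case 2 show ?case by simp
  next
    case 3 show ?case by (simp add: start_def)
  next
    case 4
    have "0 < real X * real X + 1" by (simp add: add_nonneg_pos)
    then show ?case by (simp add: nsq_start init_weight_def field_simps)
  next
    case 5 show ?case by simp
  }
next
  case (reach_letter e z g L)
  have K: "1 \<le> K" "cost L + 1 \<le> K" using K_bounds reach_letter.hyps by auto
  {
    case 1 show ?case using K(1) reach_letter.IH(1) by simp
  next
    case 2 show ?case using reach_letter.IH(2) quad_nonneg[of n] by simp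
  next
    case 3 show ?case using const[OF reach_letter.hyps(2)] dim reach_letter.IH(3)
      by (simp add: upd_def lin_coord)
  next
    case 4
    have "quad n (snd L) z + nsq n (upd n (fst L) z) \<le> cost L * nsq n z"
      unfolding cost_def using quad_le[of n "snd L" z] nsq_upd_le[of n "fst L" z] by (simp add: distrib_right)
    also have "\<dots> \<le> K * nsq n z"
      using K(2) nsq_nonneg[of n z] by (intro mult_right_mono) auto
    moreover have "g \<le> K * g"
      using K(1) reach_letter.IH(2) by (simp add: mult_le_cancel_right1)
    ultimately have le: "g + quad n (snd L) z + nsq n (upd n (fst L) z) \<le> K * (g + nsq n z)"
      by (simp add: distrib_left)
    then have "real_of_int (g + quad n (snd L) z + nsq n (upd n (fst L) z)) \<le> K * (g + nsq n z)"
      by (metis of_int_le_iff of_int_mult)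
    then have "e / K * (g + quad n (snd L) z + nsq n (upd n (fst L) z)) \<le> e / K * (K * (g + nsq n z))"
      using K(1) reach_letter.IH(1) by (intro mult_left_mono) auto
    also have "\<dots> \<le> 1"
      using reach_letter.IH(4) K(1) by simp
    finally show ?case by simp
  next
    case 5
    then have 0: "g = 0" "vanish n (snd L) z"
      using reach_letter.IH(2) quad_nonneg[of n "snd L" z] quad_eq_0_iff[of n "snd L" z] by auto
    then have "(z, upd n (fst L) z) \<in> mstep n Ls"
      using reach_letter.hyps(2) unfolding mstep_def by (cases L) auto
    with reach_letter.IH(5)[OF 0(1)] show ?case by (rule rtrancl_into_rtrancl)
  }
qed

text \<open>With \<open>e' = e / K\<close> and \<open>q = g + quad n F z\<close>, both bounds for
  \<open>1 + e' - 2 * e' * q\<close> follow from \<open>0 < e'\<close>,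
  \<open>e' \<le> e' * q\<close> and \<open>e' * q \<le> 1\<close>.\<close>

lemma factor_bounded:
  assumes "reach X e z g" "\<not> accepts n Ls F X"
  shows "\<bar>1 + e / K * (1 - 2 * (g + quad n F z))\<bar> \<le> 1"
proof -
  note r = reach_props[OF assms(1)]
  define q where "q = g + quad n F z"
  have "q \<noteq> 0"
  proof
    assume "q = 0"
    then have "g = 0" "vanish n F z"
      using r(2) quad_nonneg[of n F z] quad_eq_0_iff[of n F z] by (auto simp: q_def)
    with r(5) assms(2) show False unfolding accepts_def by blast
  qed
  \<comment> \<open>Integrality enters here.\<close>
  then have q: "1 \<le> q" using r(2) quad_nonneg[of n F z] by (simp add: q_def)
  have "quad n F z \<le> K * nsq n z"
    using quad_le[of n F z] K_bounds(3) nsq_nonneg[of n z]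
    by (meson mult_right_mono order_trans zle_add1_eq_le less_le add_le_cancel_left le_add_same_cancel1 zero_le_one)
  moreover have "g \<le> K * g"
    using K_bounds(1) r(2) by (simp add: mult_le_cancel_right1)
  ultimately have "q \<le> K * (g + nsq n z)"
    by (simp add: distrib_left q_def)
  then have "real_of_int q \<le> K * (g + nsq n z)"
    by (metis of_int_le_iff of_int_mult)
  then have "e / K * q \<le> e / K * (K * (g + nsq n z))"
    using K_bounds(1) r(1) by (intro mult_left_mono) auto
  also have "\<dots> \<le> 1"
    using r(4) K_bounds(1) by simp
  finally have "e / K * q \<le> 1" .
  moreover have "e / K * 1 \<le> e / K * q"
    using q K_bounds(1) r(1) by (intro mult_left_mono) auto
  moreover have "0 < e / K" using r(1) K_bounds(1) by simp
  moreover have "e / K * (1 - 2 * q) = e / K - 2 * (e / K * q)"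
    by (simp add: right_diff_distrib)
  ultimately show ?thesis unfolding q_def[symmetric] abs_le_iff by linarith
qed

text \<open>Words over the digits 0 and 1: letter \<open>l\<close> is written as \<open>l\<close> ones followed by a zero, and the state vector
  has one copy for each number of ones already read.\<close>

definition index :: "(nat \<times> coord_ix) set" where
  "index = {..<num_letters} \<times> coords"

text \<open>Digits from 2 on get the zero matrix, so that one construction serves every
  base.\<close>

fun digit_mat :: "nat \<Rightarrow> nat \<Rightarrow> nat \<times> coord_ix \<Rightarrow> nat \<times> coord_ix \<Rightarrow> real" where
  "digit_mat X d (l, c) (l', c') =
    (if d = 0 then if l' = 0 then letter_mat X l c c' else 0
     else if d = 1 \<and> l' = Suc l \<and> c' = c then 1 else 0)"

definition read :: "nat \<Rightarrow> (nat \<times> coord_ix \<Rightarrow> real) \<Rightarrow> nat \<Rightarrow> nat \<times> coord_ix \<Rightarrow> real" where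
  "read X x d q = (if q \<in> index then \<Sum>p\<in>index. x p * digit_mat X d p q else 0)"

definition place :: "nat \<Rightarrow> (coord_ix \<Rightarrow> real) \<Rightarrow> nat \<times> coord_ix \<Rightarrow> real" where
  "place l s p = (if p \<in> index \<and> fst p = l then s (snd p) else 0)"

text \<open>\<open>P\<close> is read in every copy: a word that ends in the leading digit 1 leaves
  the vector outside copy 0.\<close>

definition out_vec :: "nat \<times> coord_ix \<Rightarrow> real" where
  "out_vec p = (if snd p = P then 1 else 0)"

definition out :: "(nat \<times> coord_ix \<Rightarrow> real) \<Rightarrow> real" where
  "out x = (\<Sum>p\<in>index. x p * out_vec p)"

lemma sum_index: "(\<Sum>p\<in>index. f p) = (\<Sum>l<num_letters. \<Sum>c\<in>coords. f (l, c))"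
  for f :: "_ \<Rightarrow> real"
  unfolding index_def by (simp add: sum.cartesian_product)

lemma place_cong: "(\<And>c. c \<in> coords \<Longrightarrow> s c = s' c) \<Longrightarrow> place l s = place l s'"
  by (rule ext) (auto simp: place_def index_def)

lemma place_beyond: "num_letters \<le> l \<Longrightarrow> place l s = (\<lambda>_. 0)"
  by (rule ext) (auto simp: place_def index_def)

lemma sum_place:
  assumes "l < num_letters"
  shows "(\<Sum>p\<in>index. place l s p * f p) = (\<Sum>c\<in>coords. s c * f (l, c))"
proof -
  have "(\<Sum>p\<in>index. place l s p * f p) = (\<Sum>i<num_letters. if i = l then \<Sum>c\<in>coords. s c * f (l, c) else 0)"
    unfolding sum_index by (intro sum.cong) (auto simp: place_def index_def intro!: sum.cong)
  then show ?thesis using assms by simp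
qed

lemma out_place: "l < num_letters \<Longrightarrow> out (place l s) = s P"
  unfolding out_def by (simp add: sum_place out_vec_def sum_coords)

lemma read_scale: "read X (\<lambda>p. a * x p) d = (\<lambda>p. a * read X x d p)"
  by (rule ext) (simp add: read_def sum_distrib_left mult.assoc)

lemma foldl_read_scale: "foldl (read X) (\<lambda>p. a * x p) u = (\<lambda>p. a * foldl (read X) x u p)"
  by (induction u arbitrary: x) (simp_all add: read_scale)

lemma out_scale: "out (\<lambda>p. a * x p) = a * out x"
  by (simp add: out_def sum_distrib_left mult.assoc)

lemma read_0:
  assumes "l < num_letters"
  shows "read X (place l s) 0 = place 0 (apply_mat (letter_mat X l) s)"
proof
  fix q :: "nat \<times> coord_ix"
  obtain l' c' where q: "q = (l', c')" by fastforce
  show "read X (place l s) 0 q = place 0 (apply_mat (letter_mat X l) s) q"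
    unfolding read_def sum_place[OF assms] by (auto simp: q place_def apply_mat_def)
qed

lemma read_1: 
  assumes "l < num_letters"
  shows "read X (place l s) 1 = place (Suc l) s"
proof
  fix q :: "nat \<times> coord_ix"
  obtain l' c' where q: "q = (l', c')" by fastforce
  have "(\<Sum>c\<in>coords. s c * (if l' = Suc l \<and> c' = c then 1 else 0)) = (if l' = Suc l \<and> c' \<in> coords then s c' else 0)"
    using finite_coords by (cases "l' = Suc l") (simp_all add: if_distrib[of "\<lambda>x. _ * x"] cong: if_cong)
  then show "read X (place l s) 1 q = place (Suc l) s q"
    unfolding read_def sum_place[OF assms] by (auto simp: q place_def index_def)
qed

lemma read_ge_2: "2 \<le> d \<Longrightarrow> read X x d = (\<lambda>_. 0)"
proof
  fix q :: "nat \<times> coord_ix" assume "2 \<le> d"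
  then have "digit_mat X d p q = 0" for p by (cases p; cases q) auto
  then show "read X x d q = 0" by (simp only: read_def mult_zero_right sum.neutral_const if_cancel)
qed

text \<open>If \<open>X\<close> is not accepted, these vectors are closed under reading any digit,
  because factors in [-1, 1] multiply to such factors.\<close>

definition good :: "nat \<Rightarrow> (nat \<times> coord_ix \<Rightarrow> real) \<Rightarrow> bool" where
  "good X x \<longleftrightarrow> (\<exists>a l s. x = (\<lambda>p. a * place l s p) \<and> \<bar>a\<bar> \<le> 1 \<and> l < num_letters \<and>
    (s = ended \<or> (\<exists>e z g. reach X e z g \<and> s = block e z g)))"

lemma good_zero: "good X (\<lambda>_. 0)"
  unfolding good_def by (rule exI[of _ 0], rule exI[of _ 0]) (auto simp: num_letters_def)

lemma init_reach: "\<exists>e z g. reach X e z g \<and> init X = block e z g"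
  unfolding init_def using reach_start by blast

lemma good_init: "good X (place 0 (init X))"
  unfolding good_def using init_reach
  by (intro exI[of _ 1] exI[of _ 0] exI[of _ "init X"]) (simp add: num_letters_def)

lemma letter_mat_good:
  assumes "\<not> accepts n Ls F X" "l < num_letters" "s = ended \<or> (\<exists>e z g. reach X e z g \<and> s = block e z g)"
  shows "good X (place 0 (apply_mat (letter_mat X l) s))"
proof -
  have zero: "place 0 (\<lambda>_. 0) = (\<lambda>_. 0)" by (rule ext) (simp add: place_def)
  consider "l = 0" | "l = 1" | i where "l = i + 2" "i < length Ls"
    using assms(2) unfolding num_letters_def
    by (metis Suc_eq_plus1 add_2_eq_Suc' add_less_cancel_right not0_implies_Suc One_nat_def)
  then show ?thesis
  proof cases
    case 1
    with assms(3) show ?thesis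
      by (auto simp: letter_mat_def sep_ended sep_block zero good_zero good_init)
  next
    case 2
    from assms(3) show ?thesis
    proof
      assume "s = ended"
      with 2 show ?thesis by (simp add: letter_mat_def endm_ended zero good_zero)
    next
      assume "\<exists>e z g. reach X e z g \<and> s = block e z g"
      then obtain e z g where r: "reach X e z g" "s = block e z g" by blast
      let ?h = "1 + e / K * (1 - 2 * (g + quad n F z))"
      have "place 0 (apply_mat (letter_mat X l) s) = (\<lambda>p. ?h * place 0 ended p)"
        using 2 r(2) endm_block[of z, OF reach_props(3)[OF r(1)]] by (auto simp: letter_mat_def place_def)
      moreover have "\<bar>?h\<bar> \<le> 1" by (rule factor_bounded[OF r(1) assms(1)])
      moreover have "0 < num_letters" by (simp add: num_letters_def)
      ultimately show ?thesis unfolding good_def by blast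
    qed
  next
    case 3
    then have L: "Ls ! i \<in> set Ls" "letter_mat X l = inner (Ls ! i)" by (auto simp: letter_mat_def)
    from assms(3) show ?thesis
    proof
      assume "s = ended"
      with L show ?thesis by (simp add: inner_ended zero good_zero)
    next
      assume "\<exists>e z g. reach X e z g \<and> s = block e z g"
      then obtain e z g where r: "reach X e z g" "s = block e z g" by blast
      let ?s = "block (e / K) (upd n (fst (Ls ! i)) z) (g + quad n (snd (Ls ! i)) z)"
      have "place 0 (apply_mat (letter_mat X l) s) = (\<lambda>p. 1 * place 0 ?s p)"
        using L(2) r(2) place_cong[OF inner_block] by simp
      moreover have "\<exists>e z g. reach X e z g \<and> ?s = block e z g"
        using reach_letter[OF r(1) L(1)] by blast
      moreover have "0 < num_letters" "\<bar>1::real\<bar> \<le> 1" by (auto simp: num_letters_def)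
      ultimately show ?thesis unfolding good_def by blast
    qed
  qed
qed

lemma good_scale: "good X x \<Longrightarrow> \<bar>a\<bar> \<le> 1 \<Longrightarrow> good X (\<lambda>p. a * x p)"
proof -
  assume "good X x" and a: "\<bar>a\<bar> \<le> 1"
  then obtain b l s where "x = (\<lambda>p. b * place l s p)" "\<bar>b\<bar> \<le> 1" "l < num_letters"
    "s = ended \<or> (\<exists>e z g. reach X e z g \<and> s = block e z g)" unfolding good_def by blast
  moreover have "\<bar>a * b\<bar> \<le> 1" using a \<open>\<bar>b\<bar> \<le> 1\<close> by (simp add: abs_mult mult_le_one)
  moreover have "(\<lambda>p. a * (b * place l s p)) = (\<lambda>p. a * b * place l s p)" by (simp add: mult.assoc)
  ultimately show ?thesis unfolding good_def by blast
qed

lemma good_read: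
  assumes "\<not> accepts n Ls F X" "good X x"
  shows "good X (read X x d)"
proof -
  from assms(2) obtain a l s where x: "x = (\<lambda>p. a * place l s p)" "\<bar>a\<bar> \<le> 1" "l < num_letters"
    "s = ended \<or> (\<exists>e z g. reach X e z g \<and> s = block e z g)" unfolding good_def by blast
  have "good X (read X (place l s) d)"
  proof -
    consider "d = 0" | "d = 1" | "2 \<le> d" by linarith
    then show ?thesis
    proof cases
      case 1
      with x show ?thesis by (simp add: read_0 letter_mat_good[OF assms(1)])
    next
      case 2
      show ?thesis
      proof (cases "Suc l < num_letters")
        case True
        have "(\<lambda>p. 1 * place (Suc l) s p) = place (Suc l) s" "\<bar>1::real\<bar> \<le> 1" by auto
        with True x(4) show ?thesis unfolding 2 read_1[OF x(3)] good_def by metis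
      next
        \<comment> \<open>More ones than any letter has push the vector beyond the last
          copy.\<close>
        case False
        then show ?thesis unfolding 2 read_1[OF x(3)] by (simp add: place_beyond good_zero)
      qed
    next
      case 3
      then show ?thesis by (simp add: read_ge_2 good_zero)
    qed
  qed
  with x show ?thesis by (simp add: read_scale good_scale)
qed

lemma good_out: "good X x \<Longrightarrow> \<bar>out x\<bar> \<le> 1"
  unfolding good_def by (auto simp: out_scale out_place ended_def)

lemma out_bounded:
  assumes "\<not> accepts n Ls F X"
  shows "\<bar>out (foldl (read X) (place 0 (init X)) u)\<bar> \<le> 1"
proof (rule good_out)
  show "good X (foldl (read X) (place 0 (init X)) u)"
    by (induction u rule: rev_induct) (simp_all add: good_init good_read[OF assms])
qed

lemma read_ones: "l + m < num_letters \<Longrightarrow> foldl (read X) (place l s) (replicate m 1) = place (l + m) s"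
proof (induction m arbitrary: l)
  case (Suc m)
  then have "read X (place l s) 1 = place (Suc l) s" by (intro read_1) simp
  with Suc.IH[of "Suc l"] Suc.prems show ?case by simp
qed simp

lemma read_letter:
  assumes "l < num_letters"
  shows "foldl (read X) (place 0 s) (replicate l 1 @ [0]) = place 0 (apply_mat (letter_mat X l) s)"
  using assms read_ones[of 0 l] by (simp add: read_0)

text \<open>The tests along a run succeed, so \<open>g\<close> stays 0 along its word.\<close>

lemma run_word:
  assumes "(start X, z) \<in> (mstep n Ls)\<^sup>*"
  shows "\<exists>u e. set u \<subseteq> {0, 1} \<and> reach X e z 0 \<and> foldl (read X) (place 0 (init X)) u = place 0 (block e z 0)"
  using assms
proof (induction rule: rtrancl_induct)
  case base
  show ?case using reach_start[of X] by (intro exI[of _ "[]"] exI[of _ "init_weight X"]) (simp add: init_def)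
next
  case (step y z)
  then obtain u e where u: "set u \<subseteq> {0, 1}" "reach X e y 0"
    "foldl (read X) (place 0 (init X)) u = place 0 (block e y 0)" by blast
  from step.hyps(2) obtain L where L: "L \<in> set Ls" "vanish n (snd L) y" "z = upd n (fst L) y"
    unfolding mstep_def by fastforce
  then obtain i where i: "i < length Ls" "Ls ! i = L" by (auto simp: in_set_conv_nth)
  have q: "quad n (snd L) y = 0" using L(2) quad_eq_0_iff by blast
  have "letter_mat X (i + 2) = inner L" using i by (simp add: letter_mat_def)
  then have "foldl (read X) (place 0 (block e y 0)) (replicate (i + 2) 1 @ [0]) = place 0 (apply_mat (inner L) (block e y 0))"
    using read_letter[of "i + 2"] i(1) by (simp only: num_letters_def add_less_cancel_right)
  also have "\<dots> = place 0 (block (e / K) z 0)"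
    by (rule place_cong) (simp add: inner_block L(3) q)
  finally have "foldl (read X) (place 0 (init X)) (u @ replicate (i + 2) 1 @ [0]) = place 0 (block (e / K) z 0)"
    using u(3) by simp
  moreover have "reach X (e / K) z 0"
    using reach_letter[OF u(2) L(1)] q L(3) by simp
  moreover have "set (u @ replicate (i + 2) 1 @ [0]) \<subseteq> {0, 1}" using u(1) by auto
  ultimately show ?case by blast
qed

text \<open>Repeating the word of an accepting run yields the powers of a fixed
  \<open>h > 1\<close>. The final digit 1 makes the word the representation of a number.\<close>

lemma out_unbounded:
  assumes "accepts n Ls F X"
  shows "\<exists>u. set u \<subseteq> {0, 1} \<and> out (foldl (read X) (place 0 (init X)) (u @ [1])) > B"
proof -
  let ?x = "place 0 (init X)"
  obtain z where z: "(start X, z) \<in> (mstep n Ls)\<^sup>*" "vanish n F z"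
    using assms unfolding accepts_def by blast
  obtain u e where u: "set u \<subseteq> {0, 1}" "reach X e z 0" "foldl (read X) ?x u = place 0 (block e z 0)"
    using run_word[OF z(1)] by blast
  note r = reach_props[OF u(2)]
  define h where "h = 1 + e / K"
  have h: "1 < h" using r(1) K_bounds(1) by (simp add: h_def)
  have num: "1 < num_letters" by (simp add: num_letters_def)
  \<comment> \<open>The digits 1, 0 are the end marker, the last 0 is the separator.\<close>
  define w where "w = u @ [1, 0, 0]"
  have "apply_mat endm (block e z 0) = (\<lambda>c. h * ended c)"
    using endm_block[of z e 0] r(3) z(2) by (simp add: h_def quad_eq_0_iff[THEN iffD2])
  then have "place 0 (apply_mat endm (block e z 0)) = (\<lambda>p. h * place 0 ended p)"
    by (auto simp: place_def)
  moreover have "foldl (read X) (place 0 (block e z 0)) [1, 0] = place 0 (apply_mat endm (block e z 0))"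
    using read_letter[OF num, of X "block e z 0"] by (simp add: letter_mat_def)
  ultimately have "foldl (read X) ?x (u @ [1, 0]) = (\<lambda>p. h * place 0 ended p)"
    using u(3) by simp
  moreover have "read X (place 0 ended) 0 = ?x"
    using num by (simp add: read_0 letter_mat_def sep_ended)
  ultimately have w: "foldl (read X) ?x w = (\<lambda>p. h * ?x p)"
    unfolding w_def by (simp add: read_scale)
  have pow: "foldl (read X) ?x (concat (replicate m w)) = (\<lambda>p. h ^ m * ?x p)" for m
  proof (induction m)
    case (Suc m)
    then show ?case by (simp add: w foldl_read_scale mult.assoc)
  qed simp
  obtain m where m: "B < h ^ m" using real_arch_pow[OF h] by blast
  have "foldl (read X) ?x (concat (replicate m w) @ [1]) = (\<lambda>p. h ^ m * place 1 (init X) p)"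
    using read_1[of 0 X "init X"] num by (simp add: pow read_scale)
  then have "out (foldl (read X) ?x (concat (replicate m w) @ [1])) = h ^ m"
    using num by (simp add: out_scale out_place init_def del: foldl_append)
  moreover have "set (concat (replicate m w)) \<subseteq> {0, 1}"
    using u(1) by (auto simp: w_def)
  ultimately show ?thesis using m by metis
qed

end

section \<open>Linear representations and their codes\<close>

text \<open>The polynomial is \<open>x - a / b\<close> and the interval a single point. Fractions
  stay unreduced, so that codes are polynomial in their data up to pairing; the sign goes to the
  denominator, since coding \<open>- a\<close> would need a case distinction at 0.\<close>

definition frac_code :: "int \<Rightarrow> int \<Rightarrow> alg_code" where
  "frac_code a b = ([(a, - b), (1, 1)], (a, b), (a, b))"

lemma alg_denotes_frac_code:
  assumes "0 < b"
  shows "alg_denotes (frac_code a b) (of_int a / of_int b)"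
proof -
  have "irreducible [:rat_of_code (a, - b), 1:]"
    by (rule irreducible_linear_field_poly) simp
  then show ?thesis
    using assms unfolding alg_denotes_def frac_code_def Let_def
    by (auto simp: rat_of_code_def valid_rat_code_def of_rat_divide of_rat_minus map_poly_pCons)
qed

lemma alg_denotes_Rats:
  assumes "x \<in> \<rat>"
  shows "\<exists>c. alg_denotes c x"
proof -
  from assms obtain a b where "x = of_int a / of_int b" "0 < b"
    by (rule Rats_cases')
  then show ?thesis using alg_denotes_frac_code by blast
qed

text \<open>A noneffective choice is harmless: these codes enter only as finitely many
  constants.\<close>

definition code_of :: "real \<Rightarrow> alg_code" where
  "code_of x = (SOME c. alg_denotes c x)"

lemma alg_denotes_code_of: "x \<in> \<rat> \<Longrightarrow> alg_denotes (code_of x) x"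
  unfolding code_of_def by (rule someI_ex) (rule alg_denotes_Rats)

definition frac_enc :: "nat \<Rightarrow> nat \<Rightarrow> nat" where
  "frac_enc a b = list_encode [list_encode [prod_encode (2 * a, 2 * b + 1), prod_encode (2, 2)],
    prod_encode (2 * a, 2 * b + 2), prod_encode (2 * a, 2 * b + 2)]"

lemma enc_frac_code: "enc_alg (frac_code (int a) (int b + 1)) = frac_enc a b"
proof -
  have "int_encode (int m) = 2 * m" "int_encode (- int m - 1) = 2 * m + 1"
    "int_encode (int m + 1) = 2 * m + 2" "int_encode 1 = 2" for m
    by (auto simp: int_encode_def sum_encode_def nat_add_distrib)
  then show ?thesis
    by (simp add: enc_alg_def frac_code_def frac_enc_def enc_rat_def)
qed

text \<open>Only the vector \<open>v\<close> depends on the parameter \<open>X\<close>; it is also the first row of the matrix of the digit 0.\<close>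

definition vec_enc :: "nat \<Rightarrow> nat \<Rightarrow> nat" where
  "vec_enc X a =
    (let cons = (\<lambda>x xs. Suc (prod_encode (x, xs))); Y = X * X in
      cons (frac_enc 0 0) (cons (frac_enc 1 0) (cons (frac_enc 1 Y) (cons (frac_enc X Y)
        (cons (frac_enc X Y) (cons (frac_enc Y Y) a))))))"

text \<open>The numbers \<open>a\<close> to \<open>d\<close> encode what is free of
  \<open>X\<close>: the tail of the row vector, the column vector, the other rows of the first
  matrix, the other matrices. Prepending to an encoded list takes only \<open>Suc\<close> and
  \<open>prod_encode\<close>.\<close>

definition lrep_enc :: "nat \<Rightarrow> nat \<Rightarrow> nat \<Rightarrow> nat \<Rightarrow> nat \<Rightarrow> nat" where
  "lrep_enc X a b c d =
    (let cons = (\<lambda>x xs. Suc (prod_encode (x, xs))); v = vec_enc X a in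
      list_encode [v, b, cons (cons v c) d])"

section \<open>Words as numbers, and the matrices with their codes\<close>

declare digits.simps [simp del]

lemma digits_less: "d \<in> set (digits k m) \<Longrightarrow> d < k"
proof (induction k m rule: digits.induct)
  case (1 k n)
  then show ?case by (subst (asm) (2) digits.simps) (auto split: if_splits)
qed

text \<open>Digits are listed lowest first, so the final 1 is the leading digit.\<close>

lemma digits_append_1:
  assumes "2 \<le> k" "set u \<subseteq> {0, 1}"
  shows "\<exists>m > 0. digits k m = u @ [1]"
  using assms(2)
proof (induction u)
  case Nil
  have "digits k 1 = [1]" using assms(1) by (subst digits.simps, subst digits.simps) auto
  then show ?case by (intro exI[of _ 1]) simp
next
  case (Cons d u)
  then obtain m where m: "0 < m" "digits k m = u @ [1]" by auto
  have "d < k" using Cons.prems assms(1) by auto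
  then have "digits k (d + k * m) = d # digits k m"
    using m(1) assms(1) by (subst digits.simps) auto
  then show ?case using m assms(1) by (intro exI[of _ "d + k * m"]) auto
qed

context affine_machine
begin

text \<open>\<open>(0, H)\<close> stands first because its row in the matrix of digit 0 is the one
  that depends on \<open>X\<close>; the others are the positions where \<open>init X\<close> can be
  nonzero.\<close>

definition special :: "(nat \<times> coord_ix) list" where
  "special = [(0, H), (0, P), (0, T 0 0), (0, T 0 1), (0, T 1 0), (0, T 1 1)]"

lemma special_index: "set special \<subseteq> index" "distinct special"
  using dim by (auto simp: special_def index_def num_letters_def coords_mem)

lemma finite_index: "finite index"
  by (simp add: index_def finite_coords)

definition rest :: "(nat \<times> coord_ix) list" where
  "rest = (SOME xs. set xs = index - set special \<and> distinct xs)"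

lemma rest: "set rest = index - set special" "distinct rest"
proof -
  have "\<exists>xs. set xs = index - set special \<and> distinct xs"
    using finite_index by (intro finite_distinct_list) simp
  then have "set rest = index - set special \<and> distinct rest"
    unfolding rest_def by (rule someI_ex)
  then show "set rest = index - set special" "distinct rest" by auto
qed

definition ixs :: "(nat \<times> coord_ix) list" where
  "ixs = special @ rest"

lemma ixs: "set ixs = index" "distinct ixs"
  using special_index rest by (auto simp: ixs_def)

lemma sum_ixs: "(\<Sum>i<length ixs. f (ixs ! i)) = sum f index" for f :: "_ \<Rightarrow> real"
  using sum.reindex_bij_betw[OF bij_betw_nth[OF ixs(2) refl ixs(1)[symmetric]], of f] .

lemma init_weight_Rats: "init_weight X \<in> \<rat>"
  by (simp add: init_weight_def)

lemma block_Rats: "e \<in> \<rat> \<Longrightarrow> block e z g c \<in> \<rat>"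
  by (cases c) auto

lemma init_Rats: "init X c \<in> \<rat>"
  by (simp add: init_def block_Rats init_weight_Rats)

lemma endm_Rats: "endm c c' \<in> \<rat>"
  by (cases c) (auto simp: endm_def)

lemma inner_Rats: "inner L c c' \<in> \<rat>"
  by (cases c; cases c') auto

lemma digit_mat_Rats: "digit_mat X d p q \<in> \<rat>"
  by (cases p; cases q) (auto simp: letter_mat_def sep_def init_Rats endm_Rats inner_Rats)

lemma place_Rats: "(\<And>c. s c \<in> \<rat>) \<Longrightarrow> place l s p \<in> \<rat>"
  by (auto simp: place_def)

text \<open>Allows the codes of all other entries to be chosen at the parameter 0, before
  \<open>X\<close> is known.\<close>

lemma digit_mat_indep: "d \<noteq> 0 \<or> p \<noteq> (0, H) \<Longrightarrow> digit_mat X d p q = digit_mat Y d p q"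
  by (cases p; cases q) (auto simp: letter_mat_def sep_def)

lemma digit_mat_first_row: "q \<in> index \<Longrightarrow> digit_mat X 0 (0, H) q = place 0 (init X) q"
  by (cases q) (auto simp: letter_mat_def sep_def place_def)

definition row_mat :: "(nat \<times> coord_ix \<Rightarrow> real) \<Rightarrow> real mat" where
  "row_mat x = mat 1 (length ixs) (\<lambda>(_, j). x (ixs ! j))"

definition col_mat :: "(nat \<times> coord_ix \<Rightarrow> real) \<Rightarrow> real mat" where
  "col_mat x = mat (length ixs) 1 (\<lambda>(i, _). x (ixs ! i))"

definition square_mat :: "nat \<Rightarrow> nat \<Rightarrow> real mat" where
  "square_mat X d = mat (length ixs) (length ixs) (\<lambda>(i, j). digit_mat X d (ixs ! i) (ixs ! j))"

lemma row_mat_mult: "row_mat x * square_mat X d = row_mat (read X x d)"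
proof (rule eq_matI)
  fix i j assume "i < dim_row (row_mat (read X x d))" "j < dim_col (row_mat (read X x d))"
  then have ij: "i = 0" "j < length ixs" by (auto simp: row_mat_def)
  then have q: "ixs ! j \<in> index" using ixs(1) nth_mem by blast
  have "(row_mat x * square_mat X d) $$ (i, j) = (\<Sum>i<length ixs. x (ixs ! i) * digit_mat X d (ixs ! i) (ixs ! j))"
    using ij by (simp add: row_mat_def square_mat_def scalar_prod_def atLeast0LessThan)
  also have "\<dots> = (\<Sum>p\<in>index. x p * digit_mat X d p (ixs ! j))"
    by (rule sum_ixs)
  finally show "(row_mat x * square_mat X d) $$ (i, j) = row_mat (read X x d) $$ (i, j)"
    using ij q by (simp add: row_mat_def read_def)
qed (auto simp: row_mat_def square_mat_def)

lemma lrep_seq_out: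
  "lrep_seq k (row_mat x) (map (square_mat X) [0..<k]) (col_mat out_vec) m = out (foldl (read X) x (digits k m))"
proof -
  have "foldl (\<lambda>A d. A * map (square_mat X) [0..<k] ! d) (row_mat x) u = row_mat (foldl (read X) x u)"
    if "\<forall>d \<in> set u. d < k" for u
    using that by (induction u arbitrary: x) (simp_all add: row_mat_mult)
  note fold = this
  have "\<forall>d \<in> set (digits k m). d < k" using digits_less by blast
  then have "lrep_seq k (row_mat x) (map (square_mat X) [0..<k]) (col_mat out_vec) m
      = (row_mat (foldl (read X) x (digits k m)) * col_mat out_vec) $$ (0, 0)"
    unfolding lrep_seq_def by (simp only: fold)
  also have "\<dots> = out (foldl (read X) x (digits k m))"
    unfolding out_def sum_ixs[symmetric]
    by (simp add: row_mat_def col_mat_def scalar_prod_def atLeast0LessThan)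
  finally show ?thesis .
qed

lemma bounded_seq_iff:
  assumes "2 \<le> k"
  shows "bounded_seq (lrep_seq k (row_mat (place 0 (init X))) (map (square_mat X) [0..<k]) (col_mat out_vec))
    \<longleftrightarrow> \<not> accepts n Ls F X"
proof
  assume "bounded_seq (lrep_seq k (row_mat (place 0 (init X))) (map (square_mat X) [0..<k]) (col_mat out_vec))"
  then obtain B where B: "\<bar>out (foldl (read X) (place 0 (init X)) (digits k m))\<bar> \<le> B" for m
    unfolding bounded_seq_def lrep_seq_out by blast
  show "\<not> accepts n Ls F X"
  proof
    assume "accepts n Ls F X"
    then obtain u where u: "set u \<subseteq> {0, 1}" "out (foldl (read X) (place 0 (init X)) (u @ [1])) > B"
      using out_unbounded by blast
    from digits_append_1[OF assms u(1)] obtain m where m: "digits k m = u @ [1]" by blast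
    from B[of m] u(2) show False unfolding m by linarith
  qed
next
  assume "\<not> accepts n Ls F X"
  then show "bounded_seq (lrep_seq k (row_mat (place 0 (init X))) (map (square_mat X) [0..<k]) (col_mat out_vec))"
    unfolding bounded_seq_def lrep_seq_out using out_bounded by blast
qed

definition vec_code :: "nat \<Rightarrow> alg_code list" where
  "vec_code X = [frac_code 0 1, frac_code 1 1, frac_code 1 (int (X * X) + 1), frac_code (int X) (int (X * X) + 1),
     frac_code (int X) (int (X * X) + 1), frac_code (int (X * X)) (int (X * X) + 1)]
    @ map (\<lambda>_. code_of 0) rest"

definition mat_code :: "(nat \<times> coord_ix) list \<Rightarrow> nat \<Rightarrow> alg_code list list" where
  "mat_code ps d = map (\<lambda>p. map (\<lambda>q. code_of (digit_mat 0 d p q)) ixs) ps"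

definition lrep_code_of :: "nat \<Rightarrow> nat \<Rightarrow> lrep_code" where
  "lrep_code_of k X = (vec_code X, map (\<lambda>p. code_of (out_vec p)) ixs,
     (vec_code X # mat_code (tl ixs) 0) # map (mat_code ixs) [1..<k])"

lemma place_init_rest: "p \<in> set rest \<Longrightarrow> place 0 (init X) p = 0"
proof -
  assume "p \<in> set rest"
  then have p: "p \<notin> set special" using rest by auto
  obtain l c where lc: "p = (l, c)" by fastforce
  show ?thesis
  proof (cases "l = 0")
    case True
    with p lc show ?thesis
      by (cases c) (auto simp: place_def init_def special_def start_def)
  qed (simp add: place_def lc)
qed

lemma length_vec_code: "length (vec_code X) = length ixs"
  by (simp add: vec_code_def ixs_def special_def)

lemma vec_code_denotes:
  assumes "j < length ixs"
  shows "alg_denotes (vec_code X ! j) (place 0 (init X) (ixs ! j))"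
\<comment> \<open>6 is the length of \<open>special\<close>.\<close>
proof (cases "j < 6")
  case True
  define Y where "Y = int (X * X) + 1"
  have Y: "0 < Y" by (simp add: Y_def add_nonneg_pos)
  have "real_of_int Y = X * X + 1" by (simp add: Y_def)
  then have e: "init X H = of_int 0 / of_int 1" "init X P = of_int 1 / of_int 1"
    "init X (T 0 0) = of_int 1 / of_int Y" "init X (T 0 (Suc 0)) = of_int (int X) / of_int Y"
    "init X (T (Suc 0) 0) = of_int (int X) / of_int Y"
    "init X (T (Suc 0) (Suc 0)) = of_int (int (X * X)) / of_int Y"
    by (simp_all add: init_def init_weight_def start_def)
  have i: "alg_denotes (frac_code 0 1) (init X H)" "alg_denotes (frac_code 1 1) (init X P)"
    "alg_denotes (frac_code 1 Y) (init X (T 0 0))" "alg_denotes (frac_code (int X) Y) (init X (T 0 (Suc 0)))"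
    "alg_denotes (frac_code (int X) Y) (init X (T (Suc 0) 0))"
    "alg_denotes (frac_code (int (X * X)) Y) (init X (T (Suc 0) (Suc 0)))"
    unfolding e by (rule alg_denotes_frac_code, simp add: Y)+
  have p: "place 0 (init X) (0, c) = init X c" if "(0, c) \<in> set special" for c
    using that special_index by (auto simp: place_def)
  from True consider "j = 0" | "j = 1" | "j = 2" | "j = 3" | "j = 4" | "j = 5" by linarith
  then show ?thesis
    unfolding vec_code_def Y_def[symmetric]
    by cases (simp_all add: ixs_def special_def p i del: of_nat_mult)
next
  case False
  then obtain i where i: "j = i + 6" by (metis add.commute le_Suc_ex not_less)
  then have "ixs ! j = rest ! i" "vec_code X ! j = code_of 0" "i < length rest"
    using assms by (auto simp: ixs_def special_def vec_code_def)
  with place_init_rest[of "rest ! i" X] alg_denotes_code_of[of 0] show ?thesis by simp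
qed

lemma lrep_code_of_denotes:
  assumes "2 \<le> k" "\<rat> \<subseteq> S"
  shows "lrep_denotes k S (lrep_code_of k X) (row_mat (place 0 (init X))) (map (square_mat X) [0..<k])
    (col_mat out_vec)"
proof -
  let ?r = "length ixs"
  let ?ok = "\<lambda>a x. alg_denotes a x \<and> x \<in> S"
  let ?Mcs = "(vec_code X # mat_code (tl ixs) 0) # map (mat_code ixs) [1..<k]"
  have ixs0: "ixs ! 0 = (0, H)" "ixs \<noteq> []" by (simp_all add: ixs_def special_def)
  have v: "?ok (vec_code X ! j) (place 0 (init X) (ixs ! j))" if "j < ?r" for j
    using vec_code_denotes[OF that] subsetD[OF assms(2) place_Rats[OF init_Rats]] by (rule conjI)
  have w: "?ok (code_of (out_vec p)) (out_vec p)" for p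
  proof -
    have "out_vec p \<in> \<rat>" by (simp add: out_vec_def)
    then show ?thesis using alg_denotes_code_of subsetD[OF assms(2)] by blast
  qed
  have m: "?ok (code_of (digit_mat 0 d p q)) (digit_mat X d p q)" if "d \<noteq> 0 \<or> p \<noteq> (0, H)" for d p q
    unfolding digit_mat_indep[OF that, of X q 0]
    using alg_denotes_code_of[OF digit_mat_Rats] subsetD[OF assms(2) digit_mat_Rats] by (rule conjI)
  have M: "?ok (?Mcs ! d ! i ! j) (digit_mat X d (ixs ! i) (ixs ! j))" if "d < k" "i < ?r" "j < ?r" for d i j
  proof (cases d)
    case 0
    show ?thesis
    proof (cases i)
      case 0
      have "ixs ! j \<in> index" using that ixs(1) nth_mem by blast
      then show ?thesis using v[OF that(3)] \<open>d = 0\<close> 0 by (simp add: ixs0 digit_mat_first_row)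
    next
      case (Suc i')
      have "ixs ! i \<noteq> ixs ! 0" using ixs(2) that(2) Suc by (subst nth_eq_iff_index_eq) auto
      moreover have "?Mcs ! d ! i ! j = code_of (digit_mat 0 d (ixs ! i) (ixs ! j))"
        using \<open>d = 0\<close> Suc that by (simp add: mat_code_def nth_tl)
      ultimately show ?thesis using m[of d "ixs ! i" "ixs ! j"] by (simp add: ixs0)
    qed
  next
    case (Suc d')
    then have "?Mcs ! d ! i ! j = code_of (digit_mat 0 d (ixs ! i) (ixs ! j))"
      using that by (simp add: mat_code_def)
    then show ?thesis using m[of d "ixs ! i" "ixs ! j"] Suc by simp
  qed
  have len: "length M = ?r \<and> (\<forall>row \<in> set M. length row = ?r)" if "M \<in> set ?Mcs" for M
    using that ixs0(2) by (auto simp: mat_code_def length_vec_code)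
  show ?thesis
    unfolding lrep_denotes_def lrep_code_of_def Let_def prod.case length_vec_code
  proof (intro conjI allI impI ballI)
    show "length ?Mcs = k" using assms(1) by simp
    show "length (map (\<lambda>p. code_of (out_vec p)) ixs) = ?r" by simp
    show "length (map (square_mat X) [0..<k]) = k" by simp
    show "row_mat (place 0 (init X)) \<in> carrier_mat 1 ?r" by (simp add: row_mat_def)
    show "col_mat out_vec \<in> carrier_mat ?r 1" by (simp add: col_mat_def)
  next
    fix M assume "M \<in> set ?Mcs"
    from len[OF this] show "length M = ?r" by blast
    fix row assume "row \<in> set M"
    with len[OF \<open>M \<in> set ?Mcs\<close>] show "length row = ?r" by blast
  next
    fix d assume "d < k"
    then show "map (square_mat X) [0..<k] ! d \<in> carrier_mat ?r ?r" by (simp add: square_mat_def)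
  next
    fix j assume j: "j < ?r"
    from v[OF j] j show "alg_denotes (vec_code X ! j) (row_mat (place 0 (init X)) $$ (0, j))"
      "row_mat (place 0 (init X)) $$ (0, j) \<in> S" by (simp_all add: row_mat_def)
    from w[of "ixs ! j"] j show "alg_denotes (map (\<lambda>p. code_of (out_vec p)) ixs ! j) (col_mat out_vec $$ (j, 0))"
      "col_mat out_vec $$ (j, 0) \<in> S" by (simp_all add: col_mat_def)
  next
    fix d i j assume *: "d < k" "i < ?r" "j < ?r"
    from M[OF *] * show "alg_denotes (?Mcs ! d ! i ! j) (map (square_mat X) [0..<k] ! d $$ (i, j))"
      "map (square_mat X) [0..<k] ! d $$ (i, j) \<in> S" by (simp_all add: square_mat_def)
  qed
qed

lemma enc_lrep_code_of:
  "enc_lrep (lrep_code_of k X) = lrep_enc X (enc_vec (map (\<lambda>_. code_of 0) rest))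
    (enc_vec (map (\<lambda>p. code_of (out_vec p)) ixs)) (enc_mat (mat_code (tl ixs) 0))
    (list_encode (map enc_mat (map (mat_code ixs) [1..<k])))"
proof -
  have e: "enc_alg (frac_code 0 1) = frac_enc 0 0" "enc_alg (frac_code 1 1) = frac_enc 1 0"
    "enc_alg (frac_code 1 (int b + 1)) = frac_enc 1 b" for b
    using enc_frac_code[of 0 0] enc_frac_code[of 1 0] enc_frac_code[of 1 b] by simp_all
  have "enc_vec (vec_code X) = vec_enc X (enc_vec (map (\<lambda>_. code_of 0) rest))"
    unfolding enc_vec_def vec_code_def vec_enc_def Let_def by (simp add: e enc_frac_code del: of_nat_mult)
  then show ?thesis
    by (simp add: enc_lrep_def lrep_code_of_def lrep_enc_def Let_def enc_mat_def)
qed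

end

section \<open>The diagonal argument\<close>

definition tuple_enc :: "nat list \<Rightarrow> nat" where
  "tuple_enc xs = prod_encode (xs ! 0, prod_encode (xs ! 1, prod_encode (xs ! 2, xs ! 3)))"

text \<open>The parameter is the code of the remaining entries themselves: this is the
  self-reference.\<close>

definition self_enc :: "nat list \<Rightarrow> nat" where
  "self_enc xs = lrep_enc (tuple_enc xs) (xs ! 0) (xs ! 1) (xs ! 2) (xs ! 3)"

lemma computes_tuple_enc: "\<exists>f. computes f tuple_enc 4"
  unfolding tuple_enc_def[abs_def] by (intro computes_intros) simp_all

lemma computes_self_enc: "\<exists>f. computes f self_enc 4"
  unfolding self_enc_def[abs_def] lrep_enc_def vec_enc_def frac_enc_def Let_def list_encode.simps
  by (intro computes_intros computes_tuple_enc) simp_all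

text \<open>Guessing a tuple and computing \<open>J\<close> forwards replaces a program for the
  inverse of \<open>J\<close>.\<close>

lemma guess_and_check:
  assumes J: "computes j J 4"
  shows "\<exists>p. \<forall>z. (\<exists>z'. (z, z') \<in> sem p) \<longleftrightarrow> (\<exists>xs. length xs = 4 \<and> J xs = z 0 \<and> eval q xs 1)"
proof -
  let ?cj = "compile j [1, 2, 3, 4] 5 7" and ?cq = "compile q [1, 2, 3, 4] 5 7"
  \<comment> \<open>Register 0 is the input, 1 to 4 hold the tuple, 5 receives results, 6 becomes
    the constant 1, and scratch space starts at 7.\<close>
  define p where "p = seqs [guess 1, guess 2, guess 3, guess 4, ?cj, At (Tst 5 0), ?cq,
    At (Clr 6), At (Inc 6), At (Tst 5 6)]"
  have args: "set [1, 2, 3, 4] \<subseteq> {..<7::nat}" "(5::nat) < 7" by auto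
  have "(\<exists>z'. (z, z') \<in> sem p) \<longleftrightarrow> (\<exists>xs. length xs = 4 \<and> J xs = z 0 \<and> eval q xs 1)" for z
  proof
    assume "\<exists>z'. (z, z') \<in> sem p"
    then obtain a b c d z1 z2 where z1: "(z(1 := a, 2 := b, 3 := c, 4 := d), z1) \<in> sem ?cj" "z1 5 = z1 0"
      and z2: "(z1, z2) \<in> sem ?cq" "z2 5 = 1"
      unfolding p_def sem_prog_simps by auto
    note j = computes_inD[OF computes_in args z1(1)]
    note q = computes_inD[OF computes_in args z2(1)]
    have "eval j [a, b, c, d] (z1 5)" using j(1) by simp
    moreover have "eval j [a, b, c, d] (J [a, b, c, d])" using J by (simp add: computes_def)
    ultimately have "J [a, b, c, d] = z1 5" by (rule eval_deterministic[rotated])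
    moreover have "z1 0 = z 0" using j(2)[of 0] by simp
    moreover have "map z1 [1, 2, 3, 4] = [a, b, c, d]" using j(2) by simp
    then have "eval q [a, b, c, d] 1" using q(1) z2(2) by simp
    ultimately show "\<exists>xs. length xs = 4 \<and> J xs = z 0 \<and> eval q xs 1"
      using z1(2) by (intro exI[of _ "[a, b, c, d]"]) simp
  next
    assume "\<exists>xs. length xs = 4 \<and> J xs = z 0 \<and> eval q xs 1"
    then obtain xs where xs: "length xs = 4" "J xs = z 0" "eval q xs 1" by blast
    then obtain a b c d where abcd: "xs = [a, b, c, d]"
      by (auto simp: length_Suc_conv eval_nat_numeral)
    let ?z = "z(1 := a, 2 := b, 3 := c, 4 := d)"
    have "map ?z [1, 2, 3, 4] = xs" using abcd by simp
    moreover have "eval j xs (J xs)" using J xs(1) unfolding computes_def by blast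
    ultimately have "eval j (map ?z [1, 2, 3, 4]) (z 0)" using xs(2) by simp
    then obtain z1 where z1: "(?z, z1) \<in> sem ?cj" "z1 5 = z 0" "\<And>r. r < 7 \<Longrightarrow> r \<noteq> 5 \<Longrightarrow> z1 r = ?z r"
      using computes_inE[OF computes_in args] by blast
    have "map z1 [1, 2, 3, 4] = xs" using z1(3) abcd by simp
    then have "eval q (map z1 [1, 2, 3, 4]) 1" using xs(3) by simp
    then obtain z2 where z2: "(z1, z2) \<in> sem ?cq" "z2 5 = 1"
      using computes_inE[OF computes_in args] by blast
    have "z1 5 = z1 0" using z1(2) z1(3)[of 0] by simp
    then have 1: "(z1, z2(6 := Suc 0)) \<in> sem (seqs [At (Tst 5 0), ?cq, At (Clr 6), At (Inc 6), At (Tst 5 6)])"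
      using z2 unfolding sem_prog_simps by auto
    have g: "(z, z(1 := a)) \<in> sem (guess 1)" "(z(1 := a), z(1 := a, 2 := b)) \<in> sem (guess 2)"
      "(z(1 := a, 2 := b), z(1 := a, 2 := b, 3 := c)) \<in> sem (guess 3)"
      "(z(1 := a, 2 := b, 3 := c), ?z) \<in> sem (guess 4)"
      unfolding sem_guess by blast+
    have "(z, z2(6 := Suc 0)) \<in> sem p"
      using g z1(1) 1 unfolding p_def sem_seqs_Cons[of _ _ "guess _"] sem_seqs_Cons[of _ _ ?cj] by blast
    then show "\<exists>z'. (z, z') \<in> sem p" by blast
  qed
  then show ?thesis by blast
qed

theorem theorem3p5:
  fixes k :: nat and S :: "real set"
  assumes "k \<ge> 2"
    and "\<rat> \<subseteq> S" and "S \<subseteq> {x. algebraic x}"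
    and "\<forall>x \<in> S. \<forall>y \<in> S. x + y \<in> S \<and> x * y \<in> S \<and> - x \<in> S"
  shows "\<not> (\<exists>p. \<forall>c v Ms w. lrep_denotes k S c v Ms w \<longrightarrow>
              (\<exists>y. eval p [enc_lrep c] y \<and> (y = 1 \<longleftrightarrow> bounded_seq (lrep_seq k v Ms w))))"
proof
  assume "\<exists>p. \<forall>c v Ms w. lrep_denotes k S c v Ms w \<longrightarrow>
              (\<exists>y. eval p [enc_lrep c] y \<and> (y = 1 \<longleftrightarrow> bounded_seq (lrep_seq k v Ms w)))"
  then obtain p where p: "\<And>c v Ms w. lrep_denotes k S c v Ms w \<Longrightarrow>
      \<exists>y. eval p [enc_lrep c] y \<and> (y = 1 \<longleftrightarrow> bounded_seq (lrep_seq k v Ms w))"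
    by blast
  obtain j s where j: "computes j tuple_enc 4" and s: "computes s self_enc 4"
    using computes_tuple_enc computes_self_enc by blast
  obtain prog where prog: "\<And>z. (\<exists>z'. (z, z') \<in> sem prog) \<longleftrightarrow>
      (\<exists>xs. length xs = 4 \<and> tuple_enc xs = z 0 \<and> eval (Comp p [s]) xs 1)"
    using guess_and_check[OF j] by blast
  obtain n Ls F where n: "2 \<le> n" "\<forall>L \<in> set Ls. fst L 0 = coord 0"
    and acc: "\<And>X. accepts n Ls F X \<longleftrightarrow> (\<exists>z. (\<lambda>r. if r = 0 then X else 0, z) \<in> sem prog)"
    using prog_affine_machine[of prog] by blast
  interpret affine_machine n Ls F
    using n by unfold_locales auto
  \<comment> \<open>These numbers depend on the machine and on \<open>k\<close> but not on
    \<open>X\<close>, so the next definition is not circular.\<close>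
  define xs where "xs = [enc_vec (map (\<lambda>_. code_of 0) rest), enc_vec (map (\<lambda>p. code_of (out_vec p)) ixs),
    enc_mat (mat_code (tl ixs) 0), list_encode (map enc_mat (map (mat_code ixs) [1..<k]))]"
  define X where "X = tuple_enc xs"
  let ?f = "lrep_seq k (row_mat (place 0 (init X))) (map (square_mat X) [0..<k]) (col_mat out_vec)"
  have "length xs = 4" by (simp add: xs_def)
  then have s_xs: "eval s xs (self_enc xs)" using s by (simp add: computes_def)
  have self: "enc_lrep (lrep_code_of k X) = self_enc xs"
    unfolding enc_lrep_code_of self_enc_def X_def[symmetric] by (simp add: xs_def)
  have comp_iff: "eval (Comp p [s]) xs 1 \<longleftrightarrow> eval p [self_enc xs] 1"
  proof
    assume "eval (Comp p [s]) xs 1"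
    then obtain ys where "length ys = 1" "eval s xs (ys ! 0)" "eval p ys 1"
      by (rule eval_CompE) simp
    moreover from this(2) s_xs have "ys ! 0 = self_enc xs" by (rule eval_deterministic)
    ultimately show "eval p [self_enc xs] 1" by (cases ys) auto
  qed (rule eval_Comp1[OF s_xs])
  \<comment> \<open>By injectivity of the pairing the search can only find the intended
    tuple.\<close>
  have inj: "ys = xs" if "length ys = 4" "tuple_enc ys = X" for ys
    using that unfolding X_def tuple_enc_def xs_def by (auto simp: length_Suc_conv eval_nat_numeral)
  have "accepts n Ls F X \<longleftrightarrow> (\<exists>ys. length ys = 4 \<and> tuple_enc ys = X \<and> eval (Comp p [s]) ys 1)"
    unfolding acc prog by simp
  also have "\<dots> \<longleftrightarrow> eval p [self_enc xs] 1"
    unfolding comp_iff[symmetric] using inj \<open>length xs = 4\<close> X_def by blast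
  finally have *: "accepts n Ls F X \<longleftrightarrow> eval p [self_enc xs] 1" .
  from p[OF lrep_code_of_denotes[OF assms(1,2), of X]] obtain y where
    y: "eval p [self_enc xs] y" "y = 1 \<longleftrightarrow> bounded_seq ?f"
    unfolding self by blast
  \<comment> \<open>The machine accepts \<open>X\<close> iff \<open>p\<close> calls the sequence
    bounded, but acceptance makes it unbounded.\<close>
  have "y = 1 \<longleftrightarrow> \<not> eval p [self_enc xs] 1"
    unfolding y(2) bounded_seq_iff[OF assms(1)] * ..
  with y(1) eval_deterministic show False by blast
qed

end
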